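(* Let $K\subset\mathbb{R}^d$ be compact, $\mathbf p$ a Borel probability measure on $\mathcal P(K)$, $\lambda\ge0$, $n,N\in\mathbb{N}$, $\mathcal V_n$ an $n$-dimensional space of cylinder functions on $\mathcal P(K)$, $\{\ell_1,\dots,\ell_n\}$ a basis of $\mathcal V_n$ orthonormal in $L^2(\mathcal P(K),\mathbf p)$ with $\mathrm{pCE}_{2,\mathbf p}(\ell_i,\ell_j)=0$ for $i\neq j$, and $\mu_1,\dots,\mu_N$ i.i.d. with law $\mathbf p$, $\mathbf p_N:=\frac1N\sum_{j=1}^N\delta_{\mu_j}$. Let $M>0$ and $F:\mathcal P(K)\to[-M,M]$ measurable, and let $F^\star:=-M\vee S_N^{\lambda,n}(F)\wedge M$. Let $r>0$ and suppose $N\ge2$ and \[\frac{N}{\log N}\ge\frac{(1+r)K_\lambda(n)}{\sigma^\lambda_{\min,n}\,c_{1/(2\sigma^\lambda_{\max,n})}}.\] Then \[\mathbb E\big[\|F-F^\star\|^2_{L^2(\mathcal P(K),\mathbf p)}\big]\le 2e(F,n)\Big(1+\frac{c_{1/2}}{\log(N)(1+r)(1/2+\lambda\mu_{\min,n})^2}\Big)+4\lambda\,\mathrm{pCE}_{2,\mathbf p}(P_nF)+2M^2N^{-r},\] where $P_nF$ is the $L^2(\mathcal P(K),\mathbf p)$-orthogonal projection of $F$ onto $\mathcal V_n$, $e(F,n):=\|P_nF-F\|^2_{L^2(\mathcal P(K),\mathbf p)}$ and $\mu_{\min,n}:=\min_{i}\mathrm{pCE}_{2,\mathbf p}(\ell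_i)$.
   Context: $\mathcal P(K)$: Borel probability measures on $K$ with the 2-Wasserstein distance. A cylinder function is $G=\psi\circ L_{\boldsymbol\phi}$ with $L_{\boldsymbol\phi}(\mu)=(\int\phi_1d\mu,\dots,\int\phi_md\mu)$, $\psi\in C^1_b(\mathbb{R}^m)$, $\phi_i\in C^1_b$; ${\rm D}G(\mu,x)=\sum_i\partial_i\psi(L_{\boldsymbol\phi}(\mu))\nabla\phi_i(x)$. For a measure $\mathbf n$ on $\mathcal P(K)$: $\mathrm{pCE}_{2,\mathbf n}(G,H):=\int\int_K{\rm D}G(\mu,x)\cdot{\rm D}H(\mu,x)\,d\mu(x)\,d\mathbf n(\mu)$ and $\mathrm{pCE}_{2,\mathbf n}(G):=\mathrm{pCE}_{2,\mathbf n}(G,G)$. $S_N^{\lambda,n}(F)$ denotes the minimizer over $G\in\mathcal V_n$ of $\|F-G\|^2_{L^2(\mathcal P(K),\mathbf p_N)}+\lambda\,\mathrm{pCE}_{2,\mathbf p_N}(G)$. $a\vee b=\max$, $a\wedge b=\min$. $K_\lambda(n):=\sup_{\mu\in\mathcal P(K)}\sum_{i=1}^n\big(|\ell_i(\mu)|^2+\lambda\int_K|{\rm D}\ell_i(\mu,x)|^2d\mu(x)\big)$; $\sigma^\lambda_{\min,n}:=1+\lambda\min_i\mathrm{pCE}_{2,\mathbf p}(\ell_i)$; $\sigma^\lambda_{\max,n}:=1+\lambda\max_i\mathrm{pCE}_{2,\mathbf p}(\ell_i)$; $c_\delta:=(1+\delta)\log(1+\delta)-\delta$. *)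

theory Defs
  imports "HOL-Probability.Probability"
begin

text \<open>The measurable space \<open>\<P>(K)\<close>: Borel probability measures on \<open>K\<close> (viewed as measures on
  the Borel sigma-algebra of \<open>K\<close>), equipped with the Giry sigma-algebra, which for compact
  \<open>K\<close> coincides with the Borel sigma-algebra of the 2-Wasserstein (= weak) topology.\<close>
definition PK :: "'a::euclidean_space set \<Rightarrow> 'a measure measure" where
  "PK K = prob_algebra (restrict_space borel K)"

definition Lphi :: "('m::finite \<Rightarrow> 'a \<Rightarrow> real) \<Rightarrow> 'a measure \<Rightarrow> real^'m" where
  "Lphi \<phi> \<mu> = (\<chi> k. integral\<^sup>L \<mu> (\<phi> k))"

definition cyl :: "(real^'m::finite \<Rightarrow> real) \<Rightarrow> ('m \<Rightarrow> 'a \<Rightarrow> real) \<Rightarrow> 'a measure \<Rightarrow> real" where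
  "cyl \<psi> \<phi> \<mu> = \<psi> (Lphi \<phi> \<mu>)"

text \<open>\<open>DG(\<mu>,x) = \<Sum>_k \<partial>_k\<psi>(L_\<phi>(\<mu>)) \<nabla>\<phi>_k(x)\<close>, where \<open>g\<psi>\<close> is the gradient of \<open>\<psi>\<close>
  and \<open>g\<phi> k\<close> the gradient of \<open>\<phi> k\<close>.\<close>
definition Dcyl :: "(real^'m::finite \<Rightarrow> real^'m) \<Rightarrow> ('m \<Rightarrow> 'a \<Rightarrow> real) \<Rightarrow> ('m \<Rightarrow> 'a \<Rightarrow> 'a)
    \<Rightarrow> 'a measure \<Rightarrow> 'a \<Rightarrow> 'a::euclidean_space" where
  "Dcyl g\<psi> \<phi> g\<phi> \<mu> x = (\<Sum>k\<in>UNIV. (g\<psi> (Lphi \<phi> \<mu>) $ k) *\<^sub>R g\<phi> k x)"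

definition C1b_grad :: "('b::euclidean_space \<Rightarrow> real) \<Rightarrow> ('b \<Rightarrow> 'b) \<Rightarrow> bool" where
  "C1b_grad f g \<longleftrightarrow> bounded (range f) \<and> (\<forall>y. (f has_derivative (\<lambda>h. g y \<bullet> h)) (at y))
     \<and> continuous_on UNIV g \<and> bounded (range g)"

definition pCE :: "'a measure measure \<Rightarrow> ('a measure \<Rightarrow> 'a \<Rightarrow> 'a::euclidean_space)
    \<Rightarrow> ('a measure \<Rightarrow> 'a \<Rightarrow> 'a) \<Rightarrow> real" where
  "pCE n DG DH = (\<integral>\<mu>. (\<integral>x. DG \<mu> x \<bullet> DH \<mu> x \<partial>\<mu>) \<partial>n)"

definition cdelta :: "real \<Rightarrow> real" where
  "cdelta \<delta> = (1 + \<delta>) * ln (1 + \<delta>) - \<delta>"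

end

theory Submission
  imports Defs
begin

text \<open>
  The normal equations of the empirical problem have the matrix \<open>G = (X \<mu>\<^sub>1 + \<dots> + X \<mu>\<^sub>N) / N\<close>,
  where \<open>X \<mu>\<close> has entries \<open>\<ell>\<^sub>i(\<mu>) \<ell>\<^sub>j(\<mu>) + \<lambda> \<integral> D\<ell>\<^sub>i \<cdot> D\<ell>\<^sub>j d\<mu>\<close>; it is positive semidefinite with trace
  at most \<open>K\<^sub>\<lambda>(n)\<close> and mean \<open>diag (1 + \<lambda> pCE(\<ell>\<^sub>i))\<close>. On the event \<open>G \<ge> 1/2 + \<lambda> \<mu>\<^sub>m\<^sub>i\<^sub>n\<close> the distance between the
  coefficients of the minimizer and of \<open>P\<^sub>nF\<close> is controlled by the empirical inner products of
  \<open>F - P\<^sub>nF\<close> with the \<open>\<ell>\<^sub>i\<close>, whose variance is \<open>O(K\<^sub>\<lambda>(n) / N)\<close>, and by the empirical energy of \<open>P\<^sub>nF\<close>.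
  On the complement the error is at most \<open>4M\<^sup>2\<close>, and a matrix Chernoff bound makes it improbable.

  The Chernoff bound avoids matrix exponentials. With \<open>Y\<^sub>j = I - \<epsilon> X\<^sub>j\<close> and
  \<open>C\<^sub>j\<^sub>+\<^sub>1 = Y\<^sub>j C\<^sub>j Y\<^sub>j\<close>, the trace inequality \<open>tr (AB)\<^sup>q \<le> tr A\<^sup>q B\<^sup>q\<close> for symmetric \<open>A\<close>, \<open>B\<close> and
  \<open>q = 2\<^sup>k\<close> yields \<open>tr C\<^sub>j\<^sub>+\<^sub>1\<^sup>q \<le> tr C\<^sub>j\<^sup>q Y\<^sub>j\<^sup>2\<^sup>q\<close>, so the expectation decays geometrically, while a direction in
  which \<open>\<Sum> X\<^sub>j\<close> is small forces \<open>tr C\<^sub>N\<^sup>q\<close> to be large.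
\<close>

section \<open>Square matrices of variable size\<close>

text \<open>The size \<open>n\<close> is a parameter of the operations rather than of the type; only entries with
  indices below \<open>n\<close> are meaningful.\<close>

type_synonym rmat = "nat \<Rightarrow> nat \<Rightarrow> real"

context
  fixes n :: nat
begin

definition dotp :: "(nat \<Rightarrow> real) \<Rightarrow> (nat \<Rightarrow> real) \<Rightarrow> real" where
  "dotp u v = (\<Sum>i<n. u i * v i)"

definition mat_vec :: "rmat \<Rightarrow> (nat \<Rightarrow> real) \<Rightarrow> nat \<Rightarrow> real" where
  "mat_vec A v = (\<lambda>i. \<Sum>j<n. A i j * v j)"

definition mat_mul :: "rmat \<Rightarrow> rmat \<Rightarrow> rmat" where
  "mat_mul A B = (\<lambda>i j. \<Sum>k<n. A i k * B k j)"

definition mat_trace :: "rmat \<Rightarrow> real" where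
  "mat_trace A = (\<Sum>i<n. A i i)"

definition mat_transpose :: "rmat \<Rightarrow> rmat" where
  "mat_transpose A = (\<lambda>i j. A j i)"

text \<open>The power \<open>A ^ (2 ^ k)\<close>.\<close>

primrec sq_iter :: "nat \<Rightarrow> rmat \<Rightarrow> rmat" where
  "sq_iter 0 A = A"
| "sq_iter (Suc k) A = sq_iter k (mat_mul A A)"

section \<open>Algebra of the dot product, matrix products, transpose and trace\<close>

lemma dotp_commute: "dotp u v = dotp v u"
  by (simp add: dotp_def mult.commute)

lemma dotp_add_right: "dotp u (\<lambda>i. v i + w i) = dotp u v + dotp u w"
  and dotp_diff_right: "dotp u (\<lambda>i. v i - w i) = dotp u v - dotp u w"
  and dotp_scale_right: "dotp u (\<lambda>i. c * v i) = c * dotp u v"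
  by (simp_all add: dotp_def algebra_simps sum.distrib sum_subtractf sum_distrib_left)

lemma dotp_add_left: "dotp (\<lambda>i. v i + w i) u = dotp v u + dotp w u"
  and dotp_diff_left: "dotp (\<lambda>i. v i - w i) u = dotp v u - dotp w u"
  and dotp_scale_left: "dotp (\<lambda>i. c * v i) u = c * dotp v u"
  by (simp_all add: dotp_def algebra_simps sum.distrib sum_subtractf sum_distrib_left)

lemmas dotp_linear = dotp_add_right dotp_diff_right dotp_scale_right dotp_add_left dotp_diff_left dotp_scale_left

lemma dotp_self_nonneg: "0 \<le> dotp v v"
  by (simp add: dotp_def sum_nonneg)

lemma dotp_cong_right: "(\<And>i. i < n \<Longrightarrow> v i = w i) \<Longrightarrow> dotp u v = dotp u w"
  by (simp add: dotp_def)

lemma dotp_Cauchy_Schwarz: "(dotp u v)\<^sup>2 \<le> dotp u u * dotp v v"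
  using Cauchy_Schwarz_ineq_sum[of u v "{..<n}"] by (simp add: dotp_def power2_eq_square)

lemma mat_vec_cong: "(\<And>i. i < n \<Longrightarrow> v i = w i) \<Longrightarrow> mat_vec A v = mat_vec A w"
  by (simp add: mat_vec_def)

lemma mat_vec_mat_mul: "mat_vec (mat_mul A B) v = mat_vec A (mat_vec B v)"
  unfolding mat_vec_def mat_mul_def
  by (rule ext, simp add: sum_distrib_left sum_distrib_right mult.assoc, rule sum.swap)

lemma mat_vec_add: "mat_vec A (\<lambda>i. v i + w i) = (\<lambda>i. mat_vec A v i + mat_vec A w i)"
  and mat_vec_diff: "mat_vec A (\<lambda>i. v i - w i) = (\<lambda>i. mat_vec A v i - mat_vec A w i)"
  and mat_vec_scale: "mat_vec A (\<lambda>i. c * v i) = (\<lambda>i. c * mat_vec A v i)"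
  by (auto simp: mat_vec_def algebra_simps sum.distrib sum_subtractf sum_distrib_left)

lemma mat_mul_assoc: "mat_mul (mat_mul A B) C = mat_mul A (mat_mul B C)"
  unfolding mat_mul_def
  by (intro ext, simp add: sum_distrib_left sum_distrib_right mult.assoc, rule sum.swap)

lemma mat_trace_commute: "mat_trace (mat_mul A B) = mat_trace (mat_mul B A)"
  unfolding mat_trace_def mat_mul_def by (subst sum.swap) (simp add: mult.commute)

lemma mat_transpose_mat_mul: "mat_transpose (mat_mul A B) = mat_mul (mat_transpose B) (mat_transpose A)"
  by (simp add: mat_transpose_def mat_mul_def mult.commute)

lemma mat_transpose_mat_transpose [simp]: "mat_transpose (mat_transpose A) = A"
  by (simp add: mat_transpose_def)

lemma dotp_mat_vec_mat_transpose: "dotp u (mat_vec A v) = dotp (mat_vec (mat_transpose A) u) v"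
  unfolding dotp_def mat_vec_def mat_transpose_def
  by (simp add: sum_distrib_left sum_distrib_right, subst sum.swap) (simp add: ac_simps)

lemma dotp_mat_vec_commute: "mat_transpose A = A \<Longrightarrow> dotp u (mat_vec A v) = dotp v (mat_vec A u)"
  by (metis dotp_mat_vec_mat_transpose dotp_commute)

lemma mat_trace_mat_transpose_mat_mul: "mat_trace (mat_mul (mat_transpose A) B) = (\<Sum>i<n. \<Sum>j<n. A j i * B j i)"
  by (simp add: mat_trace_def mat_mul_def mat_transpose_def)

section \<open>Powers A^q with q = 2^k and their traces\<close>

lemma sq_iter_Suc_mat_mul: "sq_iter (Suc k) A = mat_mul (sq_iter k A) (sq_iter k A)"
  by (induction k arbitrary: A) simp_all

lemma mat_transpose_sq_iter: "mat_transpose (sq_iter k A) = sq_iter k (mat_transpose A)"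
  by (induction k arbitrary: A) (simp_all add: mat_transpose_mat_mul)

text \<open>With q = 2^k the common factor is B (AB)^(q-1) = (BA)^(q-1) B. It reduces cyclic
  invariance of the trace for powers to the case of two factors; squaring replaces \<open>D\<close>
  by the product \<open>D A D\<close>.\<close>

lemma sq_iter_mat_mul_factor: "\<exists>D. sq_iter k (mat_mul A B) = mat_mul A D \<and> sq_iter k (mat_mul B A) = mat_mul D A"
proof (induction k)
  case (Suc k)
  then obtain D where "sq_iter k (mat_mul A B) = mat_mul A D" "sq_iter k (mat_mul B A) = mat_mul D A" by blast
  then show ?case
    by (intro exI[of _ "mat_mul D (mat_mul A D)"]) (simp add: sq_iter_Suc_mat_mul mat_mul_assoc del: sq_iter.simps)
qed auto

lemma mat_trace_sq_iter_commute: "mat_trace (sq_iter k (mat_mul A B)) = mat_trace (sq_iter k (mat_mul B A))"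
  by (metis sq_iter_mat_mul_factor mat_trace_commute)

text \<open>A Schatten-norm Hoelder inequality; the maximum in place of the geometric mean avoids roots.\<close>

lemma mat_trace_sq_iter_mat_mul_le_max:
  "mat_trace (sq_iter k (mat_mul A B)) \<le> max (mat_trace (sq_iter k (mat_mul (mat_transpose A) A))) (mat_trace (sq_iter k (mat_mul (mat_transpose B) B)))"
proof (induction k arbitrary: A B)
  case 0
  have "mat_trace (mat_mul A B) = (\<Sum>i<n. \<Sum>j<n. A i j * B j i)"
    by (simp add: mat_trace_def mat_mul_def)
  also have "\<dots> \<le> (\<Sum>i<n. \<Sum>j<n. ((A i j)\<^sup>2 + (B j i)\<^sup>2) / 2)"
  proof (intro sum_mono)
    show "A i j * B j i \<le> ((A i j)\<^sup>2 + (B j i)\<^sup>2) / 2" for i j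
      using sum_squares_bound[of "A i j" "B j i"] by simp
  qed
  also have "\<dots> = ((\<Sum>i<n. \<Sum>j<n. (A i j)\<^sup>2) + (\<Sum>i<n. \<Sum>j<n. (B j i)\<^sup>2)) / 2"
    by (simp add: sum.distrib add_divide_distrib sum_divide_distrib)
  also have "(\<Sum>i<n. \<Sum>j<n. (A i j)\<^sup>2) = mat_trace (mat_mul (mat_transpose A) A)"
    unfolding mat_trace_mat_transpose_mat_mul by (subst sum.swap) (simp add: power2_eq_square)
  also have "(\<Sum>i<n. \<Sum>j<n. (B j i)\<^sup>2) = mat_trace (mat_mul (mat_transpose B) B)"
    unfolding mat_trace_mat_transpose_mat_mul by (simp add: power2_eq_square)
  finally show ?case by simp
next
  case (Suc k)
  \<comment> \<open>The exponent is halved by the induction hypothesis for AB paired with itself, so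
    both entries of the maximum agree. Cyclic invariance regroups the factors as (A^T A)(B B^T), and
    a second use of the hypothesis on these symmetric matrices restores the exponent.\<close>
  have "mat_trace (sq_iter (Suc k) (mat_mul A B)) \<le> mat_trace (sq_iter k (mat_mul (mat_transpose (mat_mul A B)) (mat_mul A B)))"
    using Suc[of "mat_mul A B" "mat_mul A B"] by simp
  also have "mat_mul (mat_transpose (mat_mul A B)) (mat_mul A B) = mat_mul (mat_transpose B) (mat_mul (mat_mul (mat_transpose A) A) B)"
    by (simp add: mat_transpose_mat_mul mat_mul_assoc)
  also have "mat_trace (sq_iter k \<dots>) = mat_trace (sq_iter k (mat_mul (mat_mul (mat_transpose A) A) (mat_mul B (mat_transpose B))))"
    by (subst mat_trace_sq_iter_commute) (simp add: mat_mul_assoc)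
  also have "\<dots> \<le> max (mat_trace (sq_iter k (mat_mul (mat_mul (mat_transpose A) A) (mat_mul (mat_transpose A) A))))
      (mat_trace (sq_iter k (mat_mul (mat_mul B (mat_transpose B)) (mat_mul B (mat_transpose B)))))"
    using Suc[of "mat_mul (mat_transpose A) A" "mat_mul B (mat_transpose B)"] by (simp add: mat_transpose_mat_mul)
  also have "mat_trace (sq_iter k (mat_mul (mat_mul B (mat_transpose B)) (mat_mul B (mat_transpose B)))) = mat_trace (sq_iter (Suc k) (mat_mul (mat_transpose B) B))"
    by (subst mat_trace_sq_iter_commute[of "Suc k"]) simp
  finally show ?case by simp
qed

text \<open>A case of the Araki-Lieb-Thirring inequality. The preceding inequality for AB paired
  with itself bounds tr (AB)^(2q) by tr ((AB)^T AB)^q, which by symmetry and cyclic invariance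
  equals tr (A^2 B^2)^q; the induction continues with A^2 and B^2.\<close>

lemma mat_trace_sq_iter_mat_mul_le:
  assumes "mat_transpose A = A" "mat_transpose B = B"
  shows "mat_trace (sq_iter k (mat_mul A B)) \<le> mat_trace (mat_mul (sq_iter k A) (sq_iter k B))"
  using assms
proof (induction k arbitrary: A B)
  case (Suc k)
  have "mat_trace (sq_iter (Suc k) (mat_mul A B)) \<le> mat_trace (sq_iter k (mat_mul (mat_transpose (mat_mul A B)) (mat_mul A B)))"
    using mat_trace_sq_iter_mat_mul_le_max[of k "mat_mul A B" "mat_mul A B"] by simp
  also have "mat_mul (mat_transpose (mat_mul A B)) (mat_mul A B) = mat_mul B (mat_mul (mat_mul A A) B)"
    using Suc.prems by (simp add: mat_transpose_mat_mul mat_mul_assoc)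
  also have "mat_trace (sq_iter k \<dots>) = mat_trace (sq_iter k (mat_mul (mat_mul A A) (mat_mul B B)))"
    by (subst mat_trace_sq_iter_commute) (simp add: mat_mul_assoc)
  also have "\<dots> \<le> mat_trace (mat_mul (sq_iter k (mat_mul A A)) (sq_iter k (mat_mul B B)))"
    by (rule Suc.IH) (use Suc.prems in \<open>simp_all add: mat_transpose_mat_mul\<close>)
  finally show ?case by simp
qed simp

lemma mat_vec_sq_iter: "mat_vec (sq_iter k A) v = (mat_vec A ^^ (2 ^ k)) v"
proof (induction k arbitrary: v)
  case (Suc k)
  show ?case
    by (simp only: sq_iter_Suc_mat_mul mat_vec_mat_mul Suc.IH power_Suc mult_2 funpow_add o_apply)
qed simp

text \<open>Jensen's inequality for the spectral measure of \<open>A\<close> at \<open>v\<close>,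
  obtained without a spectral decomposition: Cauchy-Schwarz gives (v . A^q v)^2 \<le> |A^q v|^2 = v
  . A^(2q) v. Semidefiniteness allows the previous bound to be squared.\<close>

lemma quad_sq_iter_ge:
  assumes "mat_transpose A = A" "\<And>u. 0 \<le> dotp u (mat_vec A u)" "dotp v v = 1"
  shows "(dotp v (mat_vec A v)) ^ (2 ^ k) \<le> dotp v (mat_vec (sq_iter k A) v)"
proof (induction k)
  case (Suc k)
  have t: "mat_transpose (sq_iter k A) = sq_iter k A"
    by (simp add: mat_transpose_sq_iter assms)
  have "(dotp v (mat_vec A v)) ^ (2 ^ Suc k) = ((dotp v (mat_vec A v)) ^ (2 ^ k))\<^sup>2"
    by (metis power_Suc2 power_mult)
  also have "\<dots> \<le> (dotp v (mat_vec (sq_iter k A) v))\<^sup>2"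
    using Suc assms by (intro power_mono) auto
  also have "\<dots> \<le> dotp v v * dotp (mat_vec (sq_iter k A) v) (mat_vec (sq_iter k A) v)"
    by (rule dotp_Cauchy_Schwarz)
  also have "\<dots> = dotp v (mat_vec (sq_iter (Suc k) A) v)"
    by (simp add: assms sq_iter_Suc_mat_mul mat_vec_mat_mul dotp_mat_vec_mat_transpose[of v "sq_iter k A"] t del: sq_iter.simps)
  finally show ?case .
qed simp

lemma quad_mat_mul_self: "mat_transpose D = D \<Longrightarrow> dotp v (mat_vec (mat_mul D D) v) = dotp (mat_vec D v) (mat_vec D v)"
  by (simp add: mat_vec_mat_mul dotp_mat_vec_mat_transpose[of v D])

text \<open>The form is |D v|^2, which Cauchy-Schwarz in each row bounds by the squared Frobenius
  norm of \<open>D\<close>; for symmetric \<open>D\<close> that norm is tr D^2.\<close>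

lemma quad_le_mat_trace_mat_mul_self:
  assumes "mat_transpose D = D" "dotp v v = 1"
  shows "dotp v (mat_vec (mat_mul D D) v) \<le> mat_trace (mat_mul D D)"
proof -
  have "dotp v (mat_vec (mat_mul D D) v) = (\<Sum>i<n. (mat_vec D v i)\<^sup>2)"
    by (simp add: quad_mat_mul_self assms) (simp add: dotp_def power2_eq_square)
  also have "\<dots> \<le> (\<Sum>i<n. dotp (D i) (D i) * dotp v v)"
    by (intro sum_mono) (metis dotp_Cauchy_Schwarz dotp_def mat_vec_def)
  also have "\<dots> = (\<Sum>i<n. dotp (D i) (D i))"
    by (simp add: assms)
  also have "\<dots> = mat_trace (mat_mul D D)"
    using assms(1) by (simp add: mat_trace_def mat_mul_def dotp_def mat_transpose_def fun_eq_iff)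
  finally show ?thesis .
qed

text \<open>For symmetric \<open>D\<close> the trace of D^2 Q is the sum of d . Q d over the rows d
  of \<open>D\<close>, so an inequality between forms passes to traces. Writing the positive weight
  as a square makes its root explicit.\<close>

lemma mat_trace_mat_mul_self_mono:
  assumes D: "mat_transpose D = D" and le: "\<And>v. dotp v (mat_vec Q v) \<le> dotp v (mat_vec R v)"
  shows "mat_trace (mat_mul (mat_mul D D) Q) \<le> mat_trace (mat_mul (mat_mul D D) R)"
proof -
  have s: "D i j = D j i" for i j using D by (metis mat_transpose_def)
  have *: "mat_trace (mat_mul (mat_mul D D) Q) = (\<Sum>i<n. dotp (D i) (mat_vec Q (D i)))" for Q
  proof -
    have "mat_trace (mat_mul (mat_mul D D) Q) = mat_trace (mat_mul D (mat_mul Q D))"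
      by (metis mat_mul_assoc mat_trace_commute)
    also have "\<dots> = (\<Sum>i<n. dotp (D i) (mat_vec Q (D i)))"
      by (simp add: mat_trace_def mat_mul_def dotp_def mat_vec_def s)
    finally show ?thesis .
  qed
  show ?thesis unfolding * by (intro sum_mono le)
qed

section \<open>The identity matrix and the factors I - \<epsilon> X\<close>

definition mat_id :: rmat where "mat_id = (\<lambda>i j. if i = j then 1 else 0)"

lemma mat_trace_sq_iter_mat_id: "mat_trace (sq_iter k mat_id) = real n"
proof -
  \<comment> \<open>Restricted to indices below \<open>n\<close>: products sum over k < n and
    therefore lose the diagonal entries of \<open>mat_id\<close> beyond that range.\<close>
  have "sq_iter k mat_id i j = mat_id i j" if "i < n" "j < n" for i j
    using that
  proof (induction k arbitrary: i j)
    case (Suc k)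
    then have "sq_iter (Suc k) mat_id i j = (\<Sum>l<n. mat_id i l * mat_id l j)"
      unfolding sq_iter_Suc_mat_mul by (simp add: mat_mul_def)
    also have "\<dots> = mat_id i j"
      using Suc.prems by (simp add: mat_id_def if_distrib[of "\<lambda>x. x * _"] sum.delta cong: if_cong)
    finally show ?case .
  qed simp
  then show ?thesis by (simp add: mat_trace_def mat_id_def)
qed

lemma dotp_mat_vec_mat_id: "dotp u (mat_vec mat_id v) = dotp u v"
  by (rule dotp_cong_right) (simp add: mat_vec_def mat_id_def if_distrib[of "\<lambda>x. x * _"] sum.delta cong: if_cong)

lemma mat_transpose_mat_id: "mat_transpose mat_id = mat_id"
  by (auto simp: mat_transpose_def mat_id_def fun_eq_iff)

definition id_minus :: "real \<Rightarrow> rmat \<Rightarrow> rmat" where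
  "id_minus \<epsilon> X = (\<lambda>i j. mat_id i j - \<epsilon> * X i j)"

lemma mat_transpose_id_minus: "mat_transpose X = X \<Longrightarrow> mat_transpose (id_minus \<epsilon> X) = id_minus \<epsilon> X"
  by (auto simp: mat_transpose_def id_minus_def mat_id_def fun_eq_iff)

lemma mat_vec_id_minus: "i < n \<Longrightarrow> mat_vec (id_minus \<epsilon> X) v i = v i - \<epsilon> * mat_vec X v i"
  by (simp add: mat_vec_def id_minus_def mat_id_def algebra_simps sum_subtractf sum_distrib_left
      if_distrib[of "\<lambda>x. _ * x"] sum.delta cong: if_cong)

lemma dotp_mat_vec_id_minus: "dotp u (mat_vec (id_minus \<epsilon> X) v) = dotp u v - \<epsilon> * dotp u (mat_vec X v)"
  by (simp add: dotp_cong_right[OF mat_vec_id_minus] dotp_linear)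

lemma mat_vec_mat_vec_id_minus: "mat_vec A (mat_vec (id_minus \<epsilon> X) v) = (\<lambda>i. mat_vec A v i - \<epsilon> * mat_vec A (mat_vec X v) i)"
  by (simp add: mat_vec_cong[OF mat_vec_id_minus] mat_vec_diff mat_vec_scale)

section \<open>Positive semidefinite matrices and powers of I - \<epsilon> X\<close>

context
  fixes X :: rmat
  assumes symX: "mat_transpose X = X"
    and psd: "\<And>v. 0 \<le> dotp v (mat_vec X v)"
begin

lemma psd_Cauchy_Schwarz: "(dotp u (mat_vec X v))\<^sup>2 \<le> dotp u (mat_vec X u) * dotp v (mat_vec X v)"
proof -
  have *: "0 \<le> dotp u (mat_vec X u) * t\<^sup>2 + 2 * dotp u (mat_vec X v) * t + dotp v (mat_vec X v)" for t
  proof -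
    have "0 \<le> dotp (\<lambda>i. t * u i + v i) (mat_vec X (\<lambda>i. t * u i + v i))" by (rule psd)
    also have "\<dots> = dotp u (mat_vec X u) * t\<^sup>2 + 2 * dotp u (mat_vec X v) * t + dotp v (mat_vec X v)"
      using dotp_mat_vec_commute[OF symX, of v u]
      by (simp add: dotp_linear mat_vec_add mat_vec_scale power2_eq_square algebra_simps)
    finally show ?thesis .
  qed
  define a b c where "a = dotp u (mat_vec X u)" "b = dotp u (mat_vec X v)" "c = dotp v (mat_vec X v)"
  have q: "0 \<le> a * t\<^sup>2 + 2 * b * t + c" for t using * by (simp add: a_b_c_def)
  have a: "0 \<le> a" using psd by (simp add: a_b_c_def)
  have "b\<^sup>2 \<le> a * c"
  proof (cases "a = 0")
    case True
    have "b = 0"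
    proof (rule ccontr)
      assume "b \<noteq> 0"
      \<comment> \<open>With a = 0 the nonnegative function 2 b t + c is affine in t, and this t
        gives it the value -1.\<close>
      then show False using q[of "(- c - 1) / (2 * b)"] True by simp
    qed
    then show ?thesis using True by simp
  next
    case False
    then show ?thesis using q[of "- b / a"] a by (simp add: field_simps power2_eq_square)
  qed
  then show ?thesis by (simp add: a_b_c_def)
qed

context
  fixes K :: real
  assumes le_K: "\<And>v. dotp v (mat_vec X v) \<le> K * dotp v v"
begin

text \<open>Cauchy-Schwarz for the form of \<open>X\<close> at \<open>X v\<close> and
  \<open>v\<close> gives |Xv|^4 \<le> K |Xv|^2 (v . Xv); cancelling |Xv|^2 leaves the operator
  inequality X^2 \<le> K X.\<close>

lemma mat_vec_sq_le: "dotp (mat_vec X v) (mat_vec X v) \<le> K * dotp v (mat_vec X v)"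
proof -
  define q where "q = dotp (mat_vec X v) (mat_vec X v)"
  have q0: "0 \<le> q" by (simp add: q_def dotp_self_nonneg)
  have "q\<^sup>2 \<le> dotp (mat_vec X v) (mat_vec X (mat_vec X v)) * dotp v (mat_vec X v)"
    using psd_Cauchy_Schwarz[of "mat_vec X v" v] by (simp add: q_def)
  also have "\<dots> \<le> K * q * dotp v (mat_vec X v)"
    using le_K[of "mat_vec X v"] psd[of v] by (intro mult_right_mono) (simp_all add: q_def)
  finally have "q * q \<le> q * (K * dotp v (mat_vec X v))"
    by (simp add: power2_eq_square algebra_simps)
  \<comment> \<open>Covers the case where the cancelled factor is 0. The sign of \<open>K\<close> is
    open here, but a negative \<open>K\<close> leaves only v . v = 0.\<close>
  moreover have "0 \<le> K * dotp v (mat_vec X v)"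
  proof (cases "0 \<le> K")
    case False
    then have "dotp v v = 0" 
      using psd[of v] le_K[of v] dotp_self_nonneg[of v] by (smt (verit) mult_neg_pos)
    then show ?thesis using psd[of v] le_K[of v] by simp
  qed (simp add: psd)
  ultimately show ?thesis using q0 unfolding q_def[symmetric]
    by (metis less_eq_real_def mult_le_cancel_left_pos)
qed

text \<open>This replaces functional calculus: \<open>Y = I - \<epsilon> X\<close> is self-adjoint for the form \<open>\<langle>u, v\<rangle> = u \<cdot> X v\<close>
  and bounded below by \<open>y = 1 - \<epsilon> K\<close> there, so \<open>v \<cdot> X Y\<^sup>i v \<ge> y\<^sup>i (v \<cdot> X v)\<close>, and
  \<open>I - Y\<^sup>m = \<epsilon> X (I + Y + \<dots> + Y\<^sup>m\<^sup>-\<^sup>1)\<close>.\<close>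

lemma quad_id_minus_sq_iter_le:
  assumes \<epsilon>: "0 \<le> \<epsilon>" "\<epsilon> * K \<le> 1" and K: "0 < K"
  shows "dotp v (mat_vec (sq_iter k (id_minus \<epsilon> X)) v) \<le> dotp v v - (1 - (1 - \<epsilon> * K) ^ (2 ^ k)) / K * dotp v (mat_vec X v)"
proof -
  define w where "w i = (mat_vec (id_minus \<epsilon> X) ^^ i) v" for i
  define s where "s i = dotp v (mat_vec X (w i))" for i
  define y where "y = 1 - \<epsilon> * K"
  have y: "0 \<le> y" using \<epsilon> by (simp add: y_def)
  have w_Suc: "w (Suc i) = mat_vec (id_minus \<epsilon> X) (w i)" for i by (simp add: w_def)
  have swap: "dotp a (mat_vec X (mat_vec (id_minus \<epsilon> X) b)) = dotp a (mat_vec X b) - \<epsilon> * dotp (mat_vec X a) (mat_vec X b)" for a b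
    using dotp_mat_vec_mat_transpose[of a X "mat_vec X b"] by (simp add: mat_vec_mat_vec_id_minus dotp_linear symX)
  \<comment> \<open>\<open>X\<close> and Y = I - \<epsilon> X commute, so powers of Y can be moved
    between the two arguments of the form; hence \<open>s\<close> at 2a is the form of
    \<open>X\<close> at the single vector \<open>w a\<close>.\<close>
  have bx: "dotp (w a) (mat_vec X (w b)) = s (a + b)" for a b
  proof (induction a arbitrary: b)
    case 0 then show ?case by (simp add: s_def w_def)
  next
    case (Suc a)
    have "dotp (w (Suc a)) (mat_vec X (w b)) = dotp (w b) (mat_vec X (w (Suc a)))"
      by (rule dotp_mat_vec_commute[OF symX])
    also have "\<dots> = dotp (w a) (mat_vec X (w (Suc b)))"
      by (simp add: w_Suc swap dotp_mat_vec_commute[OF symX, of "w b"] dotp_commute[of "mat_vec X (w b)"])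
    finally show ?case using Suc by simp
  qed
  \<comment> \<open>For i = 2a the difference of the two sides is the value at p = Y^a v of
    \<epsilon> X (K - X). For i = 2a + 1 it is that of \<epsilon> X (K - X)(y + \<epsilon> (K - X));
    its two summands are nonnegative by \<open>f1\<close> and \<open>f2\<close>.\<close>
  have s_Suc: "s (Suc i) \<ge> y * s i" for i
  proof -
    define a where "a = i div 2"
    define p where "p = w a"
    define q where "q = mat_vec X p"
    have e0: "s (a + a) = dotp p q" by (simp add: p_def q_def bx)
    have e1: "s (Suc (a + a)) = dotp p q - \<epsilon> * dotp q q"
      using bx[of a "Suc a"] by (simp add: w_Suc swap p_def q_def)
    have e2: "s (Suc (Suc (a + a))) = dotp p q - 2 * \<epsilon> * dotp q q + \<epsilon>\<^sup>2 * dotp q (mat_vec X q)"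
    proof -
      have c: "dotp (mat_vec (id_minus \<epsilon> X) p) z = dotp p z - \<epsilon> * dotp q z" for z
        by (metis dotp_commute dotp_mat_vec_id_minus q_def)
      have "s (Suc (Suc (a + a))) = dotp (mat_vec (id_minus \<epsilon> X) p) (mat_vec X (mat_vec (id_minus \<epsilon> X) p))"
        using bx[of "Suc a" "Suc a"] by (simp add: w_Suc p_def)
      also have "\<dots> = dotp p q - \<epsilon> * dotp p (mat_vec X q) - \<epsilon> * (dotp q q - \<epsilon> * dotp q (mat_vec X q))"
        unfolding c mat_vec_mat_vec_id_minus dotp_linear q_def[symmetric] by (simp add: algebra_simps)
      also have "dotp p (mat_vec X q) = dotp q q"
        using dotp_mat_vec_mat_transpose[of p X q] symX by (simp add: q_def)
      finally show ?thesis by (simp add: power2_eq_square algebra_simps)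
    qed
    have f1: "0 \<le> K * dotp p q - dotp q q" using mat_vec_sq_le[of p] by (simp add: q_def)
    have f2: "0 \<le> K\<^sup>2 * dotp p q - 2 * K * dotp q q + dotp q (mat_vec X q)"
    proof -
      have "0 \<le> dotp (\<lambda>i. K * p i - q i) (mat_vec X (\<lambda>i. K * p i - q i))" by (rule psd)
      also have "\<dots> = K\<^sup>2 * dotp p q - 2 * K * dotp q q + dotp q (mat_vec X q)"
        using dotp_mat_vec_mat_transpose[of p X q] symX
        by (simp add: mat_vec_diff mat_vec_scale dotp_linear flip: q_def) (simp add: power2_eq_square algebra_simps)
      finally show ?thesis .
    qed
    show ?thesis
    proof (cases "even i")
      case True
      then have i: "i = a + a" unfolding a_def by presburger
      have "0 \<le> \<epsilon> * (K * dotp p q - dotp q q)" using f1 \<epsilon> by simp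
      then show ?thesis unfolding i e0 e1 y_def by (simp add: algebra_simps)
    next
      case False
      then have i: "i = Suc (a + a)" unfolding a_def by presburger
      have "0 \<le> y * \<epsilon> * (K * dotp p q - dotp q q)
          + \<epsilon>\<^sup>2 * (K\<^sup>2 * dotp p q - 2 * K * dotp q q + dotp q (mat_vec X q))"
        using f1 f2 y \<epsilon> by simp
      then show ?thesis unfolding i e1 e2 y_def
        by (simp add: algebra_simps power2_eq_square)
    qed
  qed
  have s_ge: "y ^ i * s 0 \<le> s i" for i
  proof (induction i)
    case (Suc i)
    show ?case using mult_left_mono[OF Suc y] s_Suc[of i] by simp
  qed simp
  \<comment> \<open>Each step lowers v . Y^i v by \<epsilon> s(i) \<ge> \<epsilon> y^i s(0). Since
    \<epsilon> K = 1 - y, the geometric series sums to (1 - y^i) / K.\<close>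
  have "dotp v (w i) \<le> dotp v v - (1 - y ^ i) / K * s 0" for i
  proof (induction i)
    case (Suc i)
    have "dotp v (w (Suc i)) = dotp v (w i) - \<epsilon> * s i"
      by (simp add: w_Suc dotp_mat_vec_id_minus s_def)
    also have "\<dots> \<le> dotp v v - (1 - y ^ i) / K * s 0 - \<epsilon> * (y ^ i * s 0)"
      using Suc mult_left_mono[OF s_ge \<epsilon>(1), of i] by linarith
    also have "\<dots> = dotp v v - (1 - y ^ Suc i) / K * s 0"
      using K by (simp add: y_def field_simps)
    finally show ?case .
  qed (simp add: w_def)
  from this[of "2 ^ k"] show ?thesis
    by (simp add: mat_vec_sq_iter w_def s_def y_def)
qed

end

end

end

section \<open>A matrix Chernoff bound\<close>

text \<open>The right-hand power tends to exp (-2 \<theta> t) as k grows, so a large k loses at most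
  the factor 1/2. The other conditions keep I - \<epsilon> X semidefinite for \<epsilon> = \<theta>
  / 2^k, the base positive, and the powers 2^k even. In the application \<open>b\<close> is K
  N.\<close>

lemma exp_le_one_minus_power:
  fixes \<theta> t b K :: real
  assumes "0 \<le> \<theta>" "0 \<le> t" "0 \<le> b"
  shows "\<exists>k\<ge>1. \<theta> / 2 ^ k * K \<le> 1 \<and> \<theta> / 2 ^ k * t + (\<theta> / 2 ^ k * b)\<^sup>2 \<le> 1 / 2 \<and>
    exp (- (2 * \<theta> * t)) / 2 \<le> (1 - \<theta> / 2 ^ k * t - (\<theta> / 2 ^ k * b)\<^sup>2) ^ (2 ^ Suc k)"
proof -
  define c where "c = \<theta> * t + (\<theta> * b)\<^sup>2"
  have c: "0 \<le> c" using assms by (simp add: c_def)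
  \<comment> \<open>The threshold collects three needs: 2 c makes y at most 1/2, the absolute value
    makes the step size admissible, and the squares bound the loss in the exponent by 1/2.\<close>
  obtain k0 :: nat where k0: "4 * (\<theta> * b)\<^sup>2 + 8 * c\<^sup>2 + 2 * c + \<bar>\<theta> * K\<bar> < 2 ^ k0"
    using real_arch_pow[of 2] by auto
  define k where "k = Suc k0"
  define m :: real where "m = 2 ^ k"
  have m: "4 * (\<theta> * b)\<^sup>2 + 8 * c\<^sup>2 + 2 * c + \<bar>\<theta> * K\<bar> \<le> m" "1 \<le> m"
    using k0 one_le_power[of "2::real" k] by (simp_all add: m_def k_def)
  have m0: "0 < m" using m by simp
  define y where "y = \<theta> * t / m + (\<theta> * b)\<^sup>2 / m\<^sup>2"
  have ye: "\<theta> / 2 ^ k * t + (\<theta> / 2 ^ k * b)\<^sup>2 = y"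
    by (simp add: y_def m_def power2_eq_square)
  have y0: "0 \<le> y" using assms m0 by (simp add: y_def)
  have "(\<theta> * b)\<^sup>2 / m\<^sup>2 \<le> (\<theta> * b)\<^sup>2 / m"
    using m by (intro divide_left_mono) (auto simp: power2_eq_square)
  then have yc: "y \<le> c / m" by (simp add: y_def c_def add_divide_distrib)
  have b8: "0 \<le> (\<theta> * b)\<^sup>2" "0 \<le> c\<^sup>2" by simp_all
  have m': "2 * c \<le> m" "\<theta> * K \<le> m" "4 * (\<theta> * b)\<^sup>2 + 8 * c\<^sup>2 \<le> m"
    using m(1) c b8 abs_ge_self[of "\<theta> * K"] by linarith+
  have "c / m \<le> 1 / 2"
    using m'(1) m0 by (simp add: field_simps)
  with yc have y2: "y \<le> 1 / 2" by (rule order_trans)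
  have K1: "\<theta> / 2 ^ k * K \<le> 1"
    using m'(2) m0 unfolding m_def[symmetric] by (simp add: field_simps)
  have "m * y\<^sup>2 \<le> m * (c / m)\<^sup>2"
    using yc y0 m0 by (intro mult_left_mono power_mono) auto
  also have "\<dots> = c\<^sup>2 / m" using m0 by (simp add: power2_eq_square)
  finally have my: "m * y\<^sup>2 \<le> c\<^sup>2 / m" .
  \<comment> \<open>Prepares ln (1 - y) \<ge> - y - 2 y^2: everything beyond 2 \<theta> t sums to at
    most 1/2 < ln 2, which is the lost factor 1/2.\<close>
  have "2 * m * (y + 2 * y\<^sup>2) = 2 * \<theta> * t + 2 * (\<theta> * b)\<^sup>2 / m + 4 * (m * y\<^sup>2)"
    using m0 by (simp add: y_def field_simps power2_eq_square)
  also have "\<dots> \<le> 2 * \<theta> * t + (2 * (\<theta> * b)\<^sup>2 + 4 * c\<^sup>2) / m"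
    using my by (simp add: add_divide_distrib)
  also have "(2 * (\<theta> * b)\<^sup>2 + 4 * c\<^sup>2) / m \<le> 1 / 2"
    using m'(3) m0 by (simp add: field_simps)
  also have "1 / 2 \<le> ln (2 :: real)" using ln2_ge_two_thirds by simp
  finally have "- (2 * \<theta> * t) - ln 2 \<le> 2 * m * (- y - 2 * y\<^sup>2)" by (simp add: algebra_simps)
  also have "\<dots> \<le> 2 * m * ln (1 - y)"
    using ln_one_minus_pos_lower_bound[OF y0 y2] m0 by (intro mult_left_mono) auto
  finally have "exp (- (2 * \<theta> * t) - ln 2) \<le> exp (2 * m * ln (1 - y))" by simp
  also have "\<dots> = exp (real (2 ^ Suc k) * ln (1 - y))" by (simp add: m_def)
  also have "\<dots> = (1 - y) ^ (2 ^ Suc k)"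
    using y2 by (simp add: exp_of_nat_mult del: of_nat_power power_Suc)
  finally have "exp (- (2 * \<theta> * t)) / 2 \<le> (1 - y) ^ (2 ^ Suc k)"
    by (simp add: exp_diff)
  moreover have "1 - y = 1 - \<theta> / 2 ^ k * t - (\<theta> / 2 ^ k * b)\<^sup>2" using ye by simp
  ultimately have "exp (- (2 * \<theta> * t)) / 2 \<le> (1 - \<theta> / 2 ^ k * t - (\<theta> / 2 ^ k * b)\<^sup>2) ^ (2 ^ Suc k)"
    by (simp only:)
  then show ?thesis using K1 y2 ye by (intro exI[of _ k]) (auto simp: k_def)
qed

section \<open>Two-sided products of the factors I - \<epsilon> X\<close>

context
  fixes n :: nat
begin

primrec sandwich :: "real \<Rightarrow> (nat \<Rightarrow> rmat) \<Rightarrow> nat \<Rightarrow> rmat" where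
  "sandwich \<epsilon> X 0 = mat_id"
| "sandwich \<epsilon> X (Suc j) = mat_mul n (id_minus \<epsilon> (X j)) (mat_mul n (sandwich \<epsilon> X j) (id_minus \<epsilon> (X j)))"

text \<open>The half product Y_0 ... Y_(N-1) u, the newest factor acting first, so that u . C_N u is
  its squared length.\<close>

primrec sandwich_vec :: "real \<Rightarrow> (nat \<Rightarrow> rmat) \<Rightarrow> nat \<Rightarrow> (nat \<Rightarrow> real) \<Rightarrow> nat \<Rightarrow> real" where
  "sandwich_vec \<epsilon> X 0 u = u"
| "sandwich_vec \<epsilon> X (Suc j) u = sandwich_vec \<epsilon> X j (mat_vec n (id_minus \<epsilon> (X j)) u)"

lemma sandwich_cong: "(\<And>j. j < N \<Longrightarrow> X j = X' j) \<Longrightarrow> sandwich \<epsilon> X N = sandwich \<epsilon> X' N"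
  by (induction N) simp_all

lemma mat_transpose_sandwich: "(\<And>j. j < N \<Longrightarrow> mat_transpose (X j) = X j) \<Longrightarrow> mat_transpose (sandwich \<epsilon> X N) = sandwich \<epsilon> X N"
  by (induction N) (simp_all add: mat_transpose_mat_id mat_transpose_mat_mul mat_transpose_id_minus mat_mul_assoc)

lemma quad_sandwich:
  "(\<And>j. j < N \<Longrightarrow> mat_transpose (X j) = X j) \<Longrightarrow>
    dotp n u (mat_vec n (sandwich \<epsilon> X N) u) = dotp n (sandwich_vec \<epsilon> X N u) (sandwich_vec \<epsilon> X N u)"
proof (induction N arbitrary: u)
  case (Suc N)
  then show ?case
    by (simp add: mat_vec_mat_mul dotp_mat_vec_mat_transpose[of _ u "id_minus \<epsilon> (X N)"] mat_transpose_id_minus)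
qed (simp add: dotp_mat_vec_mat_id)

lemma dotp_bound:
  assumes "dotp n u u \<le> a\<^sup>2" "dotp n v v \<le> b\<^sup>2" "0 \<le> a" "0 \<le> b"
  shows "\<bar>dotp n u v\<bar> \<le> a * b"
proof -
  have "(dotp n u v)\<^sup>2 \<le> a\<^sup>2 * b\<^sup>2"
    using dotp_Cauchy_Schwarz[of n u v] assms
    by (meson dotp_self_nonneg mult_mono order_trans zero_le_power2)
  then show ?thesis
    using assms by (metis abs_le_square_iff abs_of_nonneg mult_nonneg_nonneg power_mult_distrib)
qed

lemma dotp_diff_bound:
  assumes "dotp n u u \<le> a\<^sup>2" "dotp n v v \<le> b\<^sup>2" "0 \<le> a" "0 \<le> b"
  shows "dotp n (\<lambda>i. u i - v i) (\<lambda>i. u i - v i) \<le> (a + b)\<^sup>2"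
  using dotp_bound[OF assms] assms(1,2) dotp_commute[of n u v]
  by (simp add: dotp_linear power2_eq_square algebra_simps)

context
  fixes X :: "nat \<Rightarrow> rmat" and K \<epsilon> :: real and N :: nat
  assumes symX: "\<And>j. j < N \<Longrightarrow> mat_transpose (X j) = X j"
    and psd: "\<And>j v. j < N \<Longrightarrow> 0 \<le> dotp n v (mat_vec n (X j) v)"
    and le_K: "\<And>j v. j < N \<Longrightarrow> dotp n v (mat_vec n (X j) v) \<le> K * dotp n v v"
    and K: "0 < K" and \<epsilon>: "0 \<le> \<epsilon>" "\<epsilon> * K \<le> 1"
begin

text \<open>A first-order expansion of the product: replacing the running vector by \<open>v\<close>
  in the linear terms costs an error quadratic in \<epsilon>. The induction carries a vector
  \<open>u\<close> of length at most 1 and distance at most \<open>d\<close> from \<open>v\<close>;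
  each factor is a contraction and moves it by at most \<epsilon> K.\<close>

lemma dotp_sandwich_vec_ge:
  assumes "M \<le> N" "dotp n v v = 1" "dotp n u u \<le> 1" "0 \<le> d"
    "dotp n (\<lambda>i. u i - v i) (\<lambda>i. u i - v i) \<le> d\<^sup>2"
  shows "dotp n v u - \<epsilon> * (\<Sum>j<M. dotp n v (mat_vec n (X j) v)) - \<epsilon> * K * M * (d + \<epsilon> * K * M)
    \<le> dotp n v (sandwich_vec \<epsilon> X M u)"
  using assms
proof (induction M arbitrary: u d)
  case (Suc M)
  have M: "M < N" using Suc.prems by simp
  define w where "w = mat_vec n (X M) u"
  have form: "\<bar>dotp n a (mat_vec n (X M) b)\<bar> \<le> K * (c * e)"
    if "dotp n a a \<le> c\<^sup>2" "dotp n b b \<le> e\<^sup>2" "0 \<le> c" "0 \<le> e" for a b c e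
  proof -
    have "(dotp n a (mat_vec n (X M) b))\<^sup>2 \<le> dotp n a (mat_vec n (X M) a) * dotp n b (mat_vec n (X M) b)"
      by (rule psd_Cauchy_Schwarz) (use M symX psd le_K in auto)
    also have "\<dots> \<le> (K * dotp n a a) * (K * dotp n b b)"
      using psd[OF M] le_K[OF M] K by (intro mult_mono) (auto simp: dotp_self_nonneg)
    also have "\<dots> \<le> (K * c\<^sup>2) * (K * e\<^sup>2)"
      using that K by (intro mult_mono mult_left_mono) (auto simp: dotp_self_nonneg)
    also have "\<dots> = (K * (c * e))\<^sup>2" by (simp add: power2_eq_square)
    finally show ?thesis
      using K that by (metis abs_le_square_iff abs_of_nonneg mult_nonneg_nonneg less_imp_le)
  qed
  have sq: "dotp n w w \<le> K * dotp n u w"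
    unfolding w_def by (rule mat_vec_sq_le) (use M symX psd le_K in auto)
  have uw: "0 \<le> dotp n u w" using psd[OF M] by (simp add: w_def)
  have uw1: "dotp n u w \<le> K"
    using order_trans[OF le_K[OF M, of u]] K mult_left_mono[OF Suc.prems(3), of K]
    by (simp add: w_def)
  have ww: "dotp n w w \<le> K\<^sup>2"
    using order_trans[OF sq mult_left_mono[OF uw1]] K by (simp add: power2_eq_square)
  define u' where "u' = mat_vec n (id_minus \<epsilon> (X M)) u"
  have u': "dotp n a u' = dotp n a u - \<epsilon> * dotp n a w" for a
    by (simp add: u'_def w_def dotp_mat_vec_id_minus)
  have "dotp n u' u' = dotp n u u - 2 * \<epsilon> * dotp n u w + \<epsilon>\<^sup>2 * dotp n w w"
    using u'[of u'] u'[of u] u'[of w] dotp_commute[of n u' u] dotp_commute[of n u' w] dotp_commute[of n w u]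
    by (simp add: power2_eq_square algebra_simps)
  \<comment> \<open>By X^2 \<le> K X and \<epsilon> K \<le> 1 the quadratic term cancels at most
    half of the decrease 2 \<epsilon> (u . w), so the length does not grow.\<close>
  also have "\<epsilon>\<^sup>2 * dotp n w w \<le> (\<epsilon> * K) * (\<epsilon> * dotp n u w)"
    using mult_left_mono[OF sq, of "\<epsilon>\<^sup>2"] by (simp add: power2_eq_square algebra_simps)
  also have "\<dots> \<le> 1 * (\<epsilon> * dotp n u w)"
    using \<epsilon> uw by (intro mult_right_mono) auto
  finally have n1: "dotp n u' u' \<le> 1" using Suc.prems(3) mult_nonneg_nonneg[OF \<epsilon>(1) uw] by linarith
  have "dotp n (\<lambda>i. u' i - v i) (\<lambda>i. u' i - v i)
      = dotp n (\<lambda>i. (u i - v i) - \<epsilon> * w i) (\<lambda>i. (u i - v i) - \<epsilon> * w i)"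
    unfolding dotp_def by (intro sum.cong) (simp_all add: u'_def w_def mat_vec_id_minus algebra_simps)
  also have "\<dots> \<le> (d + \<epsilon> * K)\<^sup>2"
  proof (rule dotp_diff_bound)
    show "dotp n (\<lambda>i. \<epsilon> * w i) (\<lambda>i. \<epsilon> * w i) \<le> (\<epsilon> * K)\<^sup>2"
      using mult_left_mono[OF ww, of "\<epsilon>\<^sup>2"] by (simp add: dotp_linear power2_eq_square mult.assoc mult.left_commute)
  qed (use Suc.prems K \<epsilon> in simp_all)
  finally have n2: "dotp n (\<lambda>i. u' i - v i) (\<lambda>i. u' i - v i) \<le> (d + \<epsilon> * K)\<^sup>2" .
  have IH: "dotp n v u' - \<epsilon> * (\<Sum>j<M. dotp n v (mat_vec n (X j) v)) - \<epsilon> * K * M * (d + \<epsilon> * K + \<epsilon> * K * M)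
    \<le> dotp n v (sandwich_vec \<epsilon> X M u')"
    by (rule Suc.IH) (use Suc.prems n1 n2 \<epsilon> K in auto)
  have "dotp n v w = dotp n v (mat_vec n (X M) v) + dotp n v (mat_vec n (X M) (\<lambda>i. u i - v i))"
    by (simp add: w_def mat_vec_diff dotp_linear)
  also have "dotp n v (mat_vec n (X M) (\<lambda>i. u i - v i)) \<le> K * d"
    using form[of v 1 "\<lambda>i. u i - v i" d] Suc.prems by simp
  finally have "\<epsilon> * dotp n v w \<le> \<epsilon> * (dotp n v (mat_vec n (X M) v) + K * d)"
    using \<epsilon>(1) by (intro mult_left_mono) simp_all
  \<comment> \<open>The old error with d enlarged by \<epsilon> K, plus the new error \<epsilon> K
    d, fits into the next bound with (\<epsilon> K)^2 (M + 1) to spare.\<close>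
  moreover have "\<epsilon> * K * M * (d + \<epsilon> * K + \<epsilon> * K * M) + \<epsilon> * K * d
      \<le> \<epsilon> * K * Suc M * (d + \<epsilon> * K * Suc M)"
    using \<epsilon> K by (simp add: algebra_simps)
  ultimately show ?case
    using IH u'[of v] by (simp add: u'_def[symmetric] algebra_simps)
qed simp

text \<open>The expansion at u = v bounds v . Y_0 ... Y_(N-1) v below; Cauchy-Schwarz squares this
  into a bound for v . C_N v, and Jensen raises it to the power 2^k. Since \<open>k\<close> \<ge> 1,
  the power of C_N is a square and its trace dominates its form.\<close>

lemma mat_trace_sq_iter_sandwich_ge:
  assumes v: "dotp n v v = 1" and t: "(\<Sum>j<N. dotp n v (mat_vec n (X j) v)) \<le> t"
    and pos: "0 \<le> 1 - \<epsilon> * t - (\<epsilon> * (K * N))\<^sup>2" and k: "1 \<le> k"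
  shows "(1 - \<epsilon> * t - (\<epsilon> * (K * N))\<^sup>2) ^ (2 ^ Suc k) \<le> mat_trace n (sq_iter n k (sandwich \<epsilon> X N))"
proof -
  let ?C = "sandwich \<epsilon> X N" and ?u = "sandwich_vec \<epsilon> X N v"
  have C: "mat_transpose ?C = ?C" using symX by (rule mat_transpose_sandwich)
  have qC: "dotp n u (mat_vec n ?C u) = dotp n (sandwich_vec \<epsilon> X N u) (sandwich_vec \<epsilon> X N u)" for u
    using symX by (rule quad_sandwich)
  have "1 - \<epsilon> * t - (\<epsilon> * (K * N))\<^sup>2 \<le> dotp n v ?u"
    using dotp_sandwich_vec_ge[of N v v 0] v mult_left_mono[OF t \<epsilon>(1)]
    by (simp add: dotp_def[of n "\<lambda>i. 0"] power2_eq_square algebra_simps)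
  then have "(1 - \<epsilon> * t - (\<epsilon> * (K * N))\<^sup>2)\<^sup>2 \<le> (dotp n v ?u)\<^sup>2"
    using pos by (intro power_mono)
  also have "\<dots> \<le> dotp n v (mat_vec n ?C v)"
    using dotp_Cauchy_Schwarz[of n v ?u] v by (simp add: qC)
  finally have "((1 - \<epsilon> * t - (\<epsilon> * (K * N))\<^sup>2)\<^sup>2) ^ (2 ^ k) \<le> (dotp n v (mat_vec n ?C v)) ^ (2 ^ k)"
    by (intro power_mono) auto
  also have "\<dots> \<le> dotp n v (mat_vec n (sq_iter n k ?C) v)"
    by (rule quad_sq_iter_ge[OF C _ v]) (simp add: qC dotp_self_nonneg)
  also have "\<dots> \<le> mat_trace n (sq_iter n k ?C)"
  proof -
    obtain k' where k': "k = Suc k'" using k by (cases k) auto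
    show ?thesis unfolding k' sq_iter_Suc_mat_mul
      by (rule quad_le_mat_trace_mat_mul_self) (simp_all add: mat_transpose_sq_iter C v)
  qed
  finally show ?thesis by (simp flip: power_mult)
qed

end

lemma mat_trace_mat_mul_id_minus: "mat_trace n (mat_mul n P (id_minus a X)) = mat_trace n P - a * mat_trace n (mat_mul n P X)"
  by (simp add: mat_trace_def mat_mul_def id_minus_def mat_id_def algebra_simps sum_subtractf sum_distrib_left
      if_distrib[of "\<lambda>x. _ * x"] sum.delta cong: if_cong)

text \<open>Cyclic invariance and the trace inequality give tr C_(N+1)^q \<le> tr C_N^q Y^(2q), and
  the form bound for Y^(2q) is inserted under the trace. The result is linear in \<open>X N\<close>,
  so the last sample can be averaged out.\<close>

lemma mat_trace_sq_iter_sandwich_Suc_le: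
  assumes sym: "\<And>j. j \<le> N \<Longrightarrow> mat_transpose (X j) = X j"
    and psd: "\<And>v. 0 \<le> dotp n v (mat_vec n (X N) v)"
    and le_K: "\<And>v. dotp n v (mat_vec n (X N) v) \<le> K * dotp n v v"
    and K: "0 < K" and \<epsilon>: "0 \<le> \<epsilon>" "\<epsilon> * K \<le> 1" and k: "1 \<le> k"
  defines "P \<equiv> sq_iter n k (sandwich \<epsilon> X N)"
  shows "mat_trace n (sq_iter n k (sandwich \<epsilon> X (Suc N)))
    \<le> mat_trace n P - (1 - (1 - \<epsilon> * K) ^ (2 ^ Suc k)) / K * mat_trace n (mat_mul n P (X N))"
proof -
  let ?Y = "id_minus \<epsilon> (X N)" and ?C = "sandwich \<epsilon> X N"
  have Y: "mat_transpose ?Y = ?Y" and C: "mat_transpose ?C = ?C" using sym by (simp_all add: mat_transpose_id_minus mat_transpose_sandwich)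
  obtain k' where k': "k = Suc k'" using k by (cases k) auto
  have "mat_trace n (sq_iter n k (sandwich \<epsilon> X (Suc N))) = mat_trace n (sq_iter n k (mat_mul n ?C (mat_mul n ?Y ?Y)))"
    by (simp add: mat_trace_sq_iter_commute[of n k ?Y] mat_mul_assoc)
  also have "\<dots> \<le> mat_trace n (mat_mul n P (sq_iter n k (mat_mul n ?Y ?Y)))"
    unfolding P_def by (rule mat_trace_sq_iter_mat_mul_le) (simp_all add: C Y mat_transpose_mat_mul)
  also have "\<dots> = mat_trace n (mat_mul n (mat_mul n (sq_iter n k' ?C) (sq_iter n k' ?C)) (sq_iter n (Suc k) ?Y))"
    by (simp add: P_def k' sq_iter_Suc_mat_mul[of n k' ?C] del: sq_iter.simps(2)) (simp)
  also have "\<dots> \<le> mat_trace n (mat_mul n (mat_mul n (sq_iter n k' ?C) (sq_iter n k' ?C))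
      (id_minus ((1 - (1 - \<epsilon> * K) ^ (2 ^ Suc k)) / K) (X N)))"
  proof (rule mat_trace_mat_mul_self_mono)
    show "dotp n v (mat_vec n (sq_iter n (Suc k) ?Y) v)
        \<le> dotp n v (mat_vec n (id_minus ((1 - (1 - \<epsilon> * K) ^ (2 ^ Suc k)) / K) (X N)) v)" for v
      unfolding dotp_mat_vec_id_minus by (rule quad_id_minus_sq_iter_le) (use sym psd le_K \<epsilon> K in auto)
  qed (simp add: mat_transpose_sq_iter C)
  finally show ?thesis
    by (simp add: mat_trace_mat_mul_id_minus P_def k' sq_iter_Suc_mat_mul[of n k' ?C] del: sq_iter.simps(2) power_Suc)
qed

end

section \<open>Bounded measurable functions and matrix entries\<close>

definition bounded_measurable :: "'b measure \<Rightarrow> ('b \<Rightarrow> real) \<Rightarrow> bool" where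
  "bounded_measurable M f \<longleftrightarrow> f \<in> borel_measurable M \<and> (\<exists>B. \<forall>x\<in>space M. \<bar>f x\<bar> \<le> B)"

lemma bounded_measurableI:
  "f \<in> borel_measurable M \<Longrightarrow> (\<And>x. x \<in> space M \<Longrightarrow> \<bar>f x\<bar> \<le> B) \<Longrightarrow> bounded_measurable M f"
  by (auto simp: bounded_measurable_def)

lemma bounded_measurable_const: "bounded_measurable M (\<lambda>x. c)"
  by (auto simp: bounded_measurable_def)

lemma bounded_measurable_add:
  assumes "bounded_measurable M f" "bounded_measurable M g"
  shows "bounded_measurable M (\<lambda>x. f x + g x)"
proof -
  obtain A B where "\<forall>x\<in>space M. \<bar>f x\<bar> \<le> A" "\<forall>x\<in>space M. \<bar>g x\<bar> \<le> B"
    using assms by (auto simp: bounded_measurable_def)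
  then show ?thesis
    using assms by (intro bounded_measurableI[where B="A + B"]) (force simp: bounded_measurable_def)+
qed

lemma bounded_measurable_mult:
  assumes "bounded_measurable M f" "bounded_measurable M g"
  shows "bounded_measurable M (\<lambda>x. f x * g x)"
proof -
  obtain A B where *: "\<forall>x\<in>space M. \<bar>f x\<bar> \<le> A" "\<forall>x\<in>space M. \<bar>g x\<bar> \<le> B"
    using assms by (auto simp: bounded_measurable_def)
  show ?thesis
  proof (rule bounded_measurableI[where B="A * B"])
    show "(\<lambda>x. f x * g x) \<in> borel_measurable M"
      using assms by (auto simp: bounded_measurable_def)
    show "\<bar>f x * g x\<bar> \<le> A * B" if "x \<in> space M" for x
      using * that unfolding abs_mult by (meson abs_ge_zero mult_mono order_trans)
  qed
qed

lemma bounded_measurable_diff: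
  "bounded_measurable M f \<Longrightarrow> bounded_measurable M g \<Longrightarrow> bounded_measurable M (\<lambda>x. f x - g x)"
  using bounded_measurable_add[of M f "\<lambda>x. -1 * g x"]
    bounded_measurable_mult[OF bounded_measurable_const, of M g "-1"] by simp

lemma bounded_measurable_power:
  "bounded_measurable M f \<Longrightarrow> bounded_measurable M (\<lambda>x. f x ^ k)"
  by (induction k) (auto intro: bounded_measurable_const bounded_measurable_mult)

lemma bounded_measurable_sum:
  "(\<And>i. i \<in> I \<Longrightarrow> bounded_measurable M (f i)) \<Longrightarrow> bounded_measurable M (\<lambda>x. \<Sum>i\<in>I. f i x)"
  by (induction I rule: infinite_finite_induct)
    (auto intro: bounded_measurable_const bounded_measurable_add)

lemma bounded_measurable_compose:
  "bounded_measurable N f \<Longrightarrow> g \<in> measurable M N \<Longrightarrow> bounded_measurable M (\<lambda>x. f (g x))"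
  unfolding bounded_measurable_def by (auto dest: measurable_space)

lemmas bounded_measurable_intros = bounded_measurable_const bounded_measurable_add
  bounded_measurable_diff bounded_measurable_mult bounded_measurable_power bounded_measurable_sum

text \<open>The purpose of the predicate: being closed under arithmetic, it yields integrability of
  the polynomial expressions in the samples from closure rules.\<close>

lemma (in finite_measure) integrable_bounded_measurable:
  "bounded_measurable M f \<Longrightarrow> integrable M f"
  unfolding bounded_measurable_def by (auto intro!: integrable_const_bound AE_I2)

lemma bounded_measurable_measurable: "bounded_measurable M f \<Longrightarrow> f \<in> borel_measurable M"
  by (simp add: bounded_measurable_def)

lemma bounded_measurable_mat_mul:
  assumes "\<And>i j. i < n \<Longrightarrow> j < n \<Longrightarrow> bounded_measurable M (\<lambda>x. A x i j)"
    "\<And>i j. i < n \<Longrightarrow> j < n \<Longrightarrow> bounded_measurable M (\<lambda>x. B x i j)" "i < n" "j < n"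
  shows "bounded_measurable M (\<lambda>x. mat_mul n (A x) (B x) i j)"
  unfolding mat_mul_def by (intro bounded_measurable_intros assms) auto

lemma bounded_measurable_sq_iter:
  assumes "\<And>i j. i < n \<Longrightarrow> j < n \<Longrightarrow> bounded_measurable M (\<lambda>x. A x i j)" "i < n" "j < n"
  shows "bounded_measurable M (\<lambda>x. sq_iter n k (A x) i j)"
  using assms by (induction k arbitrary: A i j) (simp_all add: bounded_measurable_mat_mul)

lemma bounded_measurable_sandwich:
  assumes "\<And>l i j. l < N \<Longrightarrow> i < n \<Longrightarrow> j < n \<Longrightarrow> bounded_measurable M (\<lambda>x. A x l i j)" "i < n" "j < n"
  shows "bounded_measurable M (\<lambda>x. sandwich n \<epsilon> (A x) N i j)"
  using assms
  by (induction N arbitrary: i j)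
    (auto intro!: bounded_measurable_mat_mul bounded_measurable_intros simp: id_minus_def)

lemma bounded_measurable_mat_trace:
  "(\<And>i j. i < n \<Longrightarrow> j < n \<Longrightarrow> bounded_measurable M (\<lambda>x. A x i j)) \<Longrightarrow>
    bounded_measurable M (\<lambda>x. mat_trace n (A x))"
  unfolding mat_trace_def by (intro bounded_measurable_intros) auto

text \<open>Fubini with the last sample innermost, the form in which inductions on the sample size
  integrate it out.\<close>

lemma integral_PiM_lessThan_Suc:
  fixes f :: "(nat \<Rightarrow> 'b) \<Rightarrow> real"
  assumes "prob_space p" "integrable (PiM {..<Suc N} (\<lambda>_. p)) f"
  shows "(\<integral>\<omega>. f \<omega> \<partial>PiM {..<Suc N} (\<lambda>_. p)) = (\<integral>\<omega>. (\<integral>x. f (fun_upd \<omega> N x) \<partial>p) \<partial>PiM {..<N} (\<lambda>_. p))"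
proof -
  interpret product_sigma_finite "\<lambda>_. p"
    using assms(1) by (simp add: product_sigma_finite_def prob_space_imp_sigma_finite)
  show ?thesis
    using product_integral_insert[of "{..<N}" N f] assms(2) by (simp add: lessThan_Suc)
qed

text \<open>Entries are values of the form at coordinate vectors, so its Cauchy-Schwarz inequality
  applies. This makes the entries of the random matrices bounded.\<close>

lemma abs_entry_le:
  assumes "mat_transpose A = A" "\<And>v. 0 \<le> dotp n v (mat_vec n A v)" "\<And>v. dotp n v (mat_vec n A v) \<le> K * dotp n v v"
    and "0 \<le> K" "i < n" "j < n"
  shows "\<bar>A i j\<bar> \<le> K"
proof -
  define e where "e l = (\<lambda>a. if a = l then 1 else 0 :: real)" for l :: nat
  have e: "dotp n (e l) v = v l" if "l < n" for l v
    using that by (simp add: dotp_def e_def if_distrib[of "\<lambda>x. x * _"] sum.delta cong: if_cong)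
  have ee: "dotp n (e l) (e l) = 1" if "l < n" for l using that e[of l "e l"] by (simp add: e_def)
  have "mat_vec n A (e j) i = A i j"
    using assms by (simp add: mat_vec_def e_def if_distrib[of "\<lambda>x. _ * x"] sum.delta cong: if_cong)
  then have "(A i j)\<^sup>2 = (dotp n (e i) (mat_vec n A (e j)))\<^sup>2" using assms e by simp
  also have "\<dots> \<le> dotp n (e i) (mat_vec n A (e i)) * dotp n (e j) (mat_vec n A (e j))"
    by (rule psd_Cauchy_Schwarz) (rule assms)+
  also have "\<dots> \<le> K * K"
    using assms(3)[of "e i"] assms(3)[of "e j"] assms
    by (intro mult_mono) (auto simp: ee)
  finally show ?thesis
    using \<open>0 \<le> K\<close> by (metis abs_le_square_iff abs_of_nonneg power2_eq_square)
qed

section \<open>Decay of the expected trace and the tail bound\<close>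

context
  fixes n :: nat and p :: "'b measure" and X :: "'b \<Rightarrow> rmat" and K \<sigma> :: real
  assumes p: "prob_space p"
    and X_meas: "\<And>i j. i < n \<Longrightarrow> j < n \<Longrightarrow> (\<lambda>x. X x i j) \<in> borel_measurable p"
    and sym: "\<And>x. x \<in> space p \<Longrightarrow> mat_transpose (X x) = X x"
    and psd: "\<And>x v. x \<in> space p \<Longrightarrow> 0 \<le> dotp n v (mat_vec n (X x) v)"
    and le_K: "\<And>x v. x \<in> space p \<Longrightarrow> dotp n v (mat_vec n (X x) v) \<le> K * dotp n v v"
    and K: "0 < K"
    and mean: "\<And>v. \<sigma> * dotp n v v \<le> dotp n v (mat_vec n (\<lambda>i j. \<integral>x. X x i j \<partial>p) v)"
    and \<sigma>: "0 \<le> \<sigma>" "\<sigma> \<le> K"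
begin

lemma bounded_measurable_X:
  "i < n \<Longrightarrow> j < n \<Longrightarrow> bounded_measurable p (\<lambda>x. X x i j)"
  using X_meas sym psd le_K K
  by (intro bounded_measurableI[where B=K] abs_entry_le[where K=K]) auto

lemma bounded_measurable_sandwich_PiM:
  assumes "N \<le> M" "i < n" "j < n"
  shows "bounded_measurable (PiM {..<M} (\<lambda>_. p)) (\<lambda>\<omega>. sq_iter n k (sandwich n \<epsilon> (\<lambda>j. X (\<omega> j)) N) i j)"
  using assms
  by (intro bounded_measurable_sq_iter bounded_measurable_sandwich
      bounded_measurable_compose[OF bounded_measurable_X]) auto

text \<open>Given the first N samples, averaging the linear bound over the last one replaces
  \<open>X\<close> by its mean, which is at least \<sigma> I as a form. Each sample thus contributes
  one factor 1 - a \<sigma>.\<close>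

lemma integral_mat_trace_sq_iter_sandwich_le:
  assumes \<epsilon>: "0 \<le> \<epsilon>" "\<epsilon> * K \<le> 1" and k: "1 \<le> k"
  shows "(\<integral>\<omega>. mat_trace n (sq_iter n k (sandwich n \<epsilon> (\<lambda>j. X (\<omega> j)) N)) \<partial>PiM {..<N} (\<lambda>_. p))
    \<le> n * (1 - (1 - (1 - \<epsilon> * K) ^ (2 ^ Suc k)) / K * \<sigma>) ^ N"
proof (induction N)
  case 0
  interpret prob_space "PiM {..<0} (\<lambda>_. p)" by (intro prob_space_PiM p)
  show ?case by (simp add: mat_trace_sq_iter_mat_id PiM_empty measure_count_space)
next
  case (Suc N)
  define P where "P \<omega> = sq_iter n k (sandwich n \<epsilon> (\<lambda>j. X (\<omega> j)) N)" for \<omega>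
  define a where "a = (1 - (1 - \<epsilon> * K) ^ (2 ^ Suc k)) / K"
  have pow: "0 \<le> (1 - \<epsilon> * K) ^ (2 ^ Suc k)" "(1 - \<epsilon> * K) ^ (2 ^ Suc k) \<le> 1"
    using \<epsilon> K by (auto intro!: power_le_one simp del: power_Suc)
  \<comment> \<open>\<sigma> \<le> K makes 1 - a \<sigma> nonnegative, so the induction hypothesis
    can be multiplied by it.\<close>
  have "a * \<sigma> \<le> 1 / K * \<sigma>"
    unfolding a_def using K \<sigma> pow by (intro mult_right_mono divide_right_mono) auto
  also have "\<dots> \<le> 1" using K \<sigma> by simp
  finally have a: "0 \<le> a" "a * \<sigma> \<le> 1"
    using K pow by (simp_all add: a_def del: power_Suc)
  interpret p: prob_space p by (rule p)
  interpret PN: prob_space "PiM {..<N} (\<lambda>_. p)" by (intro prob_space_PiM p)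
  interpret PS: prob_space "PiM {..<Suc N} (\<lambda>_. p)" by (intro prob_space_PiM p)
  have "(\<integral>\<omega>. mat_trace n (sq_iter n k (sandwich n \<epsilon> (\<lambda>j. X (\<omega> j)) (Suc N))) \<partial>PiM {..<Suc N} (\<lambda>_. p))
    = (\<integral>\<omega>. (\<integral>x. mat_trace n (sq_iter n k (sandwich n \<epsilon> (\<lambda>j. X (fun_upd \<omega> N x j)) (Suc N))) \<partial>p) \<partial>PiM {..<N} (\<lambda>_. p))"
    by (intro integral_PiM_lessThan_Suc p PS.integrable_bounded_measurable bounded_measurable_mat_trace
        bounded_measurable_sandwich_PiM) auto
  also have "\<dots> \<le> (\<integral>\<omega>. (1 - a * \<sigma>) * mat_trace n (P \<omega>) \<partial>PiM {..<N} (\<lambda>_. p))"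
  proof (rule integral_mono')
    show "integrable (PiM {..<N} (\<lambda>_. p)) (\<lambda>\<omega>. (1 - a * \<sigma>) * mat_trace n (P \<omega>))"
      unfolding P_def
      by (intro integrable_mult_right PN.integrable_bounded_measurable bounded_measurable_mat_trace
          bounded_measurable_sandwich_PiM) auto
    fix \<omega> assume \<omega>: "\<omega> \<in> space (PiM {..<N} (\<lambda>_. p))"
    then have \<omega>p: "\<omega> j \<in> space p" if "j < N" for j using that by (auto simp: space_PiM)
    \<comment> \<open>As \<open>k\<close> \<ge> 1, the weight is the square of a symmetric matrix;
      its trace is then nonnegative and form inequalities pass under it.\<close>
    obtain D where D: "mat_transpose D = D" and PD: "P \<omega> = mat_mul n D D"
    proof -
      obtain k' where k': "k = Suc k'" using k by (cases k) auto
      have "mat_transpose (sandwich n \<epsilon> (\<lambda>j. X (\<omega> j)) N) = sandwich n \<epsilon> (\<lambda>j. X (\<omega> j)) N"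
        by (intro mat_transpose_sandwich sym \<omega>p)
      then show ?thesis
        using that[of "sq_iter n k' (sandwich n \<epsilon> (\<lambda>j. X (\<omega> j)) N)"]
        by (simp add: P_def k' sq_iter_Suc_mat_mul mat_transpose_sq_iter del: sq_iter.simps)
    qed
    have tr0: "0 \<le> mat_trace n (P \<omega>)"
      using D by (simp add: PD mat_trace_def mat_mul_def mat_transpose_def fun_eq_iff sum_nonneg)
    show "0 \<le> (1 - a * \<sigma>) * mat_trace n (P \<omega>)" using tr0 a by simp
    have int: "integrable p (\<lambda>x. mat_trace n (mat_mul n (P \<omega>) (X x)))"
      by (intro p.integrable_bounded_measurable bounded_measurable_mat_trace bounded_measurable_mat_mul
          bounded_measurable_const bounded_measurable_X) auto
    have "(\<integral>x. mat_trace n (sq_iter n k (sandwich n \<epsilon> (\<lambda>j. X (fun_upd \<omega> N x j)) (Suc N))) \<partial>p)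
      \<le> (\<integral>x. mat_trace n (P \<omega>) - a * mat_trace n (mat_mul n (P \<omega>) (X x)) \<partial>p)"
    proof (rule integral_mono)
      show "integrable p (\<lambda>x. mat_trace n (P \<omega>) - a * mat_trace n (mat_mul n (P \<omega>) (X x)))"
        using int by simp
      show "integrable p (\<lambda>x. mat_trace n (sq_iter n k (sandwich n \<epsilon> (\<lambda>j. X (fun_upd \<omega> N x j)) (Suc N))))"
      proof (intro p.integrable_bounded_measurable bounded_measurable_mat_trace bounded_measurable_sq_iter
          bounded_measurable_sandwich)
        show "bounded_measurable p (\<lambda>x. X (fun_upd \<omega> N x l) i j)"
          if "l < Suc N" "i < n" "j < n" for l i j
          using that by (cases "l = N") (auto intro: bounded_measurable_X bounded_measurable_const)
      qed
      fix x assume x: "x \<in> space p"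
      have "sandwich n \<epsilon> (\<lambda>j. X (fun_upd \<omega> N x j)) N = sandwich n \<epsilon> (\<lambda>j. X (\<omega> j)) N"
        by (rule sandwich_cong) simp
      moreover have "mat_trace n (sq_iter n k (sandwich n \<epsilon> (\<lambda>j. X (fun_upd \<omega> N x j)) (Suc N)))
        \<le> mat_trace n (sq_iter n k (sandwich n \<epsilon> (\<lambda>j. X (fun_upd \<omega> N x j)) N))
          - (1 - (1 - \<epsilon> * K) ^ (2 ^ Suc k)) / K
            * mat_trace n (mat_mul n (sq_iter n k (sandwich n \<epsilon> (\<lambda>j. X (fun_upd \<omega> N x j)) N)) (X (fun_upd \<omega> N x N)))"
        by (rule mat_trace_sq_iter_sandwich_Suc_le) (use x \<omega>p sym psd le_K K \<epsilon> k in auto)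
      ultimately show "mat_trace n (sq_iter n k (sandwich n \<epsilon> (\<lambda>j. X (fun_upd \<omega> N x j)) (Suc N)))
        \<le> mat_trace n (P \<omega>) - a * mat_trace n (mat_mul n (P \<omega>) (X x))"
        by (simp add: P_def a_def del: power_Suc sandwich.simps)
    qed
    also have "\<dots> = mat_trace n (P \<omega>) - a * (\<integral>x. mat_trace n (mat_mul n (P \<omega>) (X x)) \<partial>p)"
      using int by (simp add: p.prob_space)
    also have "(\<integral>x. mat_trace n (mat_mul n (P \<omega>) (X x)) \<partial>p) = mat_trace n (mat_mul n (P \<omega>) (\<lambda>i j. \<integral>x. X x i j \<partial>p))"
    proof -
      have "integrable p (\<lambda>x. X x i j)" if "i < n" "j < n" for i j
        using that by (intro p.integrable_bounded_measurable bounded_measurable_X)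
      then have int: "integrable p (\<lambda>x. P \<omega> i k * X x k i)" if "i < n" "k < n" for i k
        using that by simp
      have "(\<integral>x. mat_trace n (mat_mul n (P \<omega>) (X x)) \<partial>p) = (\<Sum>i<n. \<integral>x. (\<Sum>k<n. P \<omega> i k * X x k i) \<partial>p)"
        unfolding mat_trace_def mat_mul_def
        by (intro Bochner_Integration.integral_sum Bochner_Integration.integrable_sum) (use int in auto)
      also have "\<dots> = (\<Sum>i<n. \<Sum>k<n. \<integral>x. P \<omega> i k * X x k i \<partial>p)"
        by (intro sum.cong refl Bochner_Integration.integral_sum) (use int in auto)
      finally show ?thesis by (simp add: mat_trace_def mat_mul_def)
    qed
    finally have le: "(\<integral>x. mat_trace n (sq_iter n k (sandwich n \<epsilon> (\<lambda>j. X (fun_upd \<omega> N x j)) (Suc N))) \<partial>p)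
      \<le> mat_trace n (P \<omega>) - a * mat_trace n (mat_mul n (P \<omega>) (\<lambda>i j. \<integral>x. X x i j \<partial>p))" .
    have "\<sigma> * mat_trace n (P \<omega>) \<le> mat_trace n (mat_mul n (P \<omega>) (\<lambda>i j. \<integral>x. X x i j \<partial>p))"
    proof -
      have "\<sigma> * mat_trace n (P \<omega>) = mat_trace n (mat_mul n (mat_mul n D D) (\<lambda>i j. \<sigma> * mat_id i j))"
        by (simp add: PD mat_trace_def mat_mul_def[of n "mat_mul n D D"] mat_id_def sum_distrib_left
            if_distrib[of "\<lambda>x. _ * x"] sum.delta cong: if_cong) (simp add: mult.commute)
      also have "\<dots> \<le> mat_trace n (mat_mul n (mat_mul n D D) (\<lambda>i j. \<integral>x. X x i j \<partial>p))"
      proof (rule mat_trace_mat_mul_self_mono[OF D])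
        fix v
        have "mat_vec n (\<lambda>i j. \<sigma> * mat_id i j) v = (\<lambda>i. \<sigma> * mat_vec n mat_id v i)"
          by (simp add: mat_vec_def sum_distrib_left mult.assoc)
        then show "dotp n v (mat_vec n (\<lambda>i j. \<sigma> * mat_id i j) v) \<le> dotp n v (mat_vec n (\<lambda>i j. \<integral>x. X x i j \<partial>p) v)"
          using mean[of v] by (simp add: dotp_scale_right dotp_mat_vec_mat_id)
      qed
      finally show ?thesis by (simp add: PD)
    qed
    from le mult_left_mono[OF this a(1)] show "(\<integral>x. mat_trace n (sq_iter n k (sandwich n \<epsilon> (\<lambda>j. X (fun_upd \<omega> N x j)) (Suc N))) \<partial>p)
      \<le> (1 - a * \<sigma>) * mat_trace n (P \<omega>)"
      by (simp add: algebra_simps del: sandwich.simps)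
  qed
  also have "\<dots> = (1 - a * \<sigma>) * (\<integral>\<omega>. mat_trace n (P \<omega>) \<partial>PiM {..<N} (\<lambda>_. p))"
    by simp
  also have "\<dots> \<le> (1 - a * \<sigma>) * (n * (1 - a * \<sigma>) ^ N)"
    using Suc.IH a by (intro mult_left_mono) (simp_all add: P_def a_def del: power_Suc)
  finally show ?case by (simp add: a_def mult_ac)
qed

text \<open>The bad event is dominated by an integrable function \<open>h\<close> because its measurability, which
  involves a quantifier over all directions \<open>v\<close>, is never needed.\<close>

theorem matrix_Chernoff_lower_tail:
  assumes s: "0 \<le> s" and t: "0 \<le> t"
  obtains h where "integrable (PiM {..<N} (\<lambda>_. p)) h" "\<And>\<omega>. \<omega> \<in> space (PiM {..<N} (\<lambda>_. p)) \<Longrightarrow> 0 \<le> h \<omega>"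
    "\<And>\<omega> v. \<omega> \<in> space (PiM {..<N} (\<lambda>_. p)) \<Longrightarrow> dotp n v v = 1 \<Longrightarrow>
      (\<Sum>j<N. dotp n v (mat_vec n (X (\<omega> j)) v)) \<le> t \<Longrightarrow> 1 \<le> h \<omega>"
    "(\<integral>\<omega>. h \<omega> \<partial>PiM {..<N} (\<lambda>_. p)) \<le> 2 * n * exp (s * t) * (1 - (1 - exp (- (s * K))) / K * \<sigma>) ^ N"
proof -
  \<comment> \<open>Each sample enters through (I - \<epsilon> X)^(2q) with \<epsilon> = \<theta> /
    q, which approximates exp (-2 \<theta> X); hence 2 \<theta> = s.\<close>
  define \<theta> where "\<theta> = s / 2"
  have \<theta>: "0 \<le> \<theta>" "2 * \<theta> = s" using s by (simp_all add: \<theta>_def)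
  obtain k where k: "1 \<le> k" "\<theta> / 2 ^ k * K \<le> 1"
      "\<theta> / 2 ^ k * t + (\<theta> / 2 ^ k * (K * N))\<^sup>2 \<le> 1 / 2"
      "exp (- (2 * \<theta> * t)) / 2 \<le> (1 - \<theta> / 2 ^ k * t - (\<theta> / 2 ^ k * (K * N))\<^sup>2) ^ (2 ^ Suc k)"
    using exp_le_one_minus_power[of \<theta> t "K * N" K] \<theta> t K by auto
  define \<epsilon> where "\<epsilon> = \<theta> / 2 ^ k"
  have \<epsilon>: "0 \<le> \<epsilon>" "\<epsilon> * K \<le> 1" using \<theta> k by (simp_all add: \<epsilon>_def)
  define g where "g \<omega> = mat_trace n (sq_iter n k (sandwich n \<epsilon> (\<lambda>j. X (\<omega> j)) N))" for \<omega>
  \<comment> \<open>The factor is the reciprocal of exp (- s t) / 2, the lower bound for the trace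
    on the bad event, so \<open>h\<close> is at least 1 there.\<close>
  define h where "h \<omega> = 2 * exp (s * t) * g \<omega>" for \<omega>
  interpret PN: prob_space "PiM {..<N} (\<lambda>_. p)" by (intro prob_space_PiM p)
  have int: "integrable (PiM {..<N} (\<lambda>_. p)) g"
    unfolding g_def by (intro PN.integrable_bounded_measurable bounded_measurable_mat_trace
          bounded_measurable_sandwich_PiM) auto
  show thesis
  proof
    show "integrable (PiM {..<N} (\<lambda>_. p)) h"
      unfolding h_def using int by simp
    fix \<omega> assume \<omega>: "\<omega> \<in> space (PiM {..<N} (\<lambda>_. p))"
    then have \<omega>p: "\<omega> j \<in> space p" if "j < N" for j using that by (auto simp: space_PiM)
    have C: "mat_transpose (sandwich n \<epsilon> (\<lambda>j. X (\<omega> j)) N) = sandwich n \<epsilon> (\<lambda>j. X (\<omega> j)) N"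
      by (intro mat_transpose_sandwich sym \<omega>p)
    obtain k' where k': "k = Suc k'" using k by (cases k) auto
    define D where "D = sq_iter n k' (sandwich n \<epsilon> (\<lambda>j. X (\<omega> j)) N)"
    have D: "mat_transpose D = D" using C by (simp add: D_def mat_transpose_sq_iter)
    have "0 \<le> g \<omega>"
      unfolding g_def k' sq_iter_Suc_mat_mul D_def[symmetric]
      using D by (simp add: mat_trace_def mat_mul_def mat_transpose_def fun_eq_iff sum_nonneg)
    then show "0 \<le> h \<omega>" by (simp add: h_def)
    fix v assume v: "dotp n v v = 1" "(\<Sum>j<N. dotp n v (mat_vec n (X (\<omega> j)) v)) \<le> t"
    have "exp (- (s * t)) / 2 \<le> (1 - \<epsilon> * t - (\<epsilon> * (K * N))\<^sup>2) ^ (2 ^ Suc k)"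
      using k(4) \<theta> by (simp add: \<epsilon>_def)
    also have "\<dots> \<le> g \<omega>"
      unfolding g_def
      by (rule mat_trace_sq_iter_sandwich_ge[where K=K]) (use \<omega>p sym psd le_K K \<epsilon> k v in \<open>auto simp: \<epsilon>_def\<close>)
    finally show "1 \<le> h \<omega>"
      by (simp add: h_def exp_minus field_simps)
  next
    \<comment> \<open>The rate \<open>a\<close> depends on \<open>k\<close>. Since (1 - \<epsilon>
      K)^(2q) \<le> exp (- s K), it is at least \<open>b\<close>, and the auxiliary parameters leave
      the bound.\<close>
    define a b where "a = (1 - (1 - \<epsilon> * K) ^ (2 ^ Suc k)) / K" and "b = (1 - exp (- (s * K))) / K"
    have "(1 - \<epsilon> * K) ^ (2 ^ Suc k) \<le> exp (- (\<epsilon> * K)) ^ (2 ^ Suc k)"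
      using \<epsilon> exp_ge_add_one_self[of "- (\<epsilon> * K)"] by (intro power_mono) auto
    also have "\<dots> = exp (real (2 ^ Suc k) * - (\<epsilon> * K))"
      by (rule exp_of_nat_mult[symmetric])
    also have "real (2 ^ Suc k) * - (\<epsilon> * K) = - (s * K)"
      using \<theta> by (simp add: \<epsilon>_def)
    finally have ab: "b \<le> a" using K by (simp add: a_def b_def divide_right_mono)
    have "0 \<le> (1 - \<epsilon> * K) ^ (2 ^ Suc k)" using \<epsilon> by simp
    then have "a * \<sigma> \<le> 1 / K * \<sigma>"
      unfolding a_def using K \<sigma> by (intro mult_right_mono divide_right_mono) auto
    also have "\<dots> \<le> 1" using K \<sigma> by simp
    finally have a1: "a * \<sigma> \<le> 1" .
    have "(\<integral>\<omega>. h \<omega> \<partial>PiM {..<N} (\<lambda>_. p)) = 2 * exp (s * t) * (\<integral>\<omega>. g \<omega> \<partial>PiM {..<N} (\<lambda>_. p))"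
      by (simp add: h_def)
    also have "\<dots> \<le> 2 * exp (s * t) * (n * (1 - a * \<sigma>) ^ N)"
      unfolding g_def a_def by (intro mult_left_mono integral_mat_trace_sq_iter_sandwich_le \<epsilon> k) auto
    also have "\<dots> \<le> 2 * exp (s * t) * (n * (1 - b * \<sigma>) ^ N)"
      using ab a1 \<sigma> by (intro mult_left_mono power_mono) (auto intro: mult_right_mono)
    finally show "(\<integral>\<omega>. h \<omega> \<partial>PiM {..<N} (\<lambda>_. p))
        \<le> 2 * n * exp (s * t) * (1 - (1 - exp (- (s * K))) / K * \<sigma>) ^ N"
      by (simp add: b_def mult_ac)
  qed
qed

end

section \<open>Consequences of the sample size condition\<close>

lemma cdelta_has_derivative:
  "x > -1 \<Longrightarrow> (cdelta has_real_derivative ln (1 + x)) (at x)"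
  unfolding cdelta_def[abs_def] by (auto intro!: derivative_eq_intros)

lemma cdelta_0 [simp]: "cdelta 0 = 0"
  by (simp add: cdelta_def)

lemma cdelta_le_sq_half:
  assumes "0 \<le> x" shows "cdelta x \<le> x\<^sup>2 / 2"
proof -
  have "(\<lambda>x. x\<^sup>2 / 2 - cdelta x) 0 \<le> (\<lambda>x. x\<^sup>2 / 2 - cdelta x) x"
  proof (rule DERIV_nonneg_imp_nondecreasing[OF assms])
    show "\<exists>y. ((\<lambda>x. x\<^sup>2 / 2 - cdelta x) has_real_derivative y) (at u) \<and> 0 \<le> y" if "0 \<le> u" "u \<le> x" for u
      using that ln_add_one_self_le_self[of u]
      by (intro exI[of _ "u - ln (1 + u)"]) (auto intro!: derivative_eq_intros cdelta_has_derivative)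
  qed
  then show ?thesis by simp
qed

lemma cdelta_pos:
  assumes "0 < x" shows "0 < cdelta x"
proof -
  have "cdelta 0 < cdelta x"
  proof (rule DERIV_pos_imp_increasing_open[OF assms])
    show "\<exists>y. (cdelta has_real_derivative y) (at u) \<and> 0 < y" if "0 < u" "u < x" for u
      using that by (intro exI[of _ "ln (1 + u)"]) (auto intro!: cdelta_has_derivative)
    show "continuous_on {0..x} cdelta"
      by (rule DERIV_continuous_on[where D="\<lambda>u. ln (1 + u)"])
        (auto intro!: DERIV_subset[OF cdelta_has_derivative])
  qed
  then show ?thesis by simp
qed

text \<open>The quotient has derivative (u - ln (1 + u)) / u^2 \<ge> 0. It serves to compare
  \<open>cdelta \<delta>\<close> with \<open>cdelta (1 / 2)\<close>.\<close>

lemma cdelta_div_mono: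
  assumes "0 < x" "x \<le> y" shows "cdelta x / x \<le> cdelta y / y"
proof (rule DERIV_nonneg_imp_nondecreasing[OF assms(2)])
  show "\<exists>d. ((\<lambda>x. cdelta x / x) has_real_derivative d) (at u) \<and> 0 \<le> d" if "x \<le> u" "u \<le> y" for u
  proof (intro exI conjI)
    have u: "0 < u" using that assms by simp
    show "((\<lambda>x. cdelta x / x) has_real_derivative (ln (1 + u) * u - cdelta u * 1) / (u * u)) (at u)"
      using u by (intro DERIV_divide cdelta_has_derivative DERIV_ident) auto
    have "ln (1 + u) * u - cdelta u = u - ln (1 + u)" by (simp add: cdelta_def algebra_simps)
    then show "0 \<le> (ln (1 + u) * u - cdelta u * 1) / (u * u)"
      using ln_add_one_self_le_self[of u] u by simp
  qed
qed

text \<open>The difference of the two sides vanishes at 0 and has derivative - ln (1 - u^2) \<ge> 0.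
  The right side is the exponent that the lower tail produces, the left side the one in the sample
  size condition.\<close>

lemma cdelta_le_lower_tail:
  assumes "0 \<le> x" "x < 1" shows "cdelta x \<le> (1 - x) * ln (1 - x) + x"
proof -
  let ?f = "\<lambda>x. (1 - x) * ln (1 - x) + x - cdelta x"
  have "?f 0 \<le> ?f x"
  proof (rule DERIV_nonneg_imp_nondecreasing[OF assms(1)])
    show "\<exists>d. (?f has_real_derivative d) (at u) \<and> 0 \<le> d" if "0 \<le> u" "u \<le> x" for u
    proof (intro exI conjI)
      have u: "0 \<le> u" "u < 1" using that assms by auto
      show "(?f has_real_derivative - ln (1 - u) - ln (1 + u)) (at u)"
        using u by (auto intro!: derivative_eq_intros cdelta_has_derivative)
      have "ln (1 - u) \<le> - u" using u ln_le_minus_one[of "1 - u"] by simp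
      then show "0 \<le> - ln (1 - u) - ln (1 + u)"
        using ln_add_one_self_le_self[of u] u by simp
    qed
  qed
  then show ?thesis by simp
qed

section \<open>Numerical consequences for dimension, tail and variance\<close>

context
  fixes lam r Kl mmin mmax \<delta> :: real and n N :: nat
  assumes lam: "0 \<le> lam" and r: "0 < r" and m: "0 \<le> mmin" "mmin \<le> mmax"
    and n: "1 \<le> n" and N: "2 \<le> N"
    and \<delta>: "\<delta> = 1 / (2 * (1 + lam * mmax))"
    and Kl: "n * (1 + lam * mmin) \<le> Kl"
    and sample_size: "real N / ln (real N)
        \<ge> (1 + r) * Kl / ((1 + lam * mmin) * cdelta \<delta>)"
begin

abbreviation (input) "\<sigma> \<equiv> 1 + lam * mmin"

lemma sigma_ge_1: "1 \<le> \<sigma>"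
  using lam m by simp

lemma delta_bounds: "0 < \<delta>" "\<delta> \<le> 1 / 2"
proof -
  have "0 \<le> lam * mmax" using lam m by simp
  then show "0 < \<delta>" "\<delta> \<le> 1 / 2" by (simp_all add: \<delta> field_simps)
qed

lemma sigma_delta: "\<sigma> * \<delta> \<le> 1 / 2"
proof -
  have "lam * mmin \<le> lam * mmax" "0 \<le> lam * mmax" using lam m by (auto intro: mult_left_mono)
  then show ?thesis by (simp add: \<delta> field_simps)
qed

lemma Kl_pos: "0 < Kl" "\<sigma> \<le> Kl"
proof -
  have "1 * \<sigma> \<le> n * \<sigma>" using n sigma_ge_1 by (intro mult_right_mono) auto
  then show "\<sigma> \<le> Kl" using Kl by simp
  then show "0 < Kl" using sigma_ge_1 by simp
qed

lemma sample_size': "(1 + r) * Kl * ln N \<le> N * \<sigma> * cdelta \<delta>"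
proof -
  have "0 < ln (real N)" "0 < \<sigma> * cdelta \<delta>"
    using N sigma_ge_1 cdelta_pos[OF delta_bounds(1)] by auto
  then show ?thesis using sample_size by (simp add: field_simps)
qed

lemma cdelta_le_eighth: "cdelta \<delta> \<le> 1 / 8" "cdelta (1 / 2) \<le> 1 / 8"
proof -
  have "cdelta \<delta> \<le> \<delta>\<^sup>2 / 2" using delta_bounds by (intro cdelta_le_sq_half) auto
  also have "\<dots> \<le> (1 / 2)\<^sup>2 / 2" using delta_bounds by (intro divide_right_mono power_mono) auto
  finally show "cdelta \<delta> \<le> 1 / 8" by (simp add: power2_eq_square)
  show "cdelta (1 / 2) \<le> 1 / 8" using cdelta_le_sq_half[of "1 / 2"] by (simp add: power2_eq_square)
qed

text \<open>With Kl \<ge> n \<sigma>, ln N \<ge> 1/2 and \<open>cdelta \<delta>\<close> \<le> 1/8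
  the sample size condition leaves n / 2 \<le> N / 8. The dimension factor of the tail bound is paid
  for with this.\<close>

lemma four_n_le: "4 * n \<le> N"
proof -
  have lnN: "1 / 2 \<le> ln (real N)"
  proof -
    have "ln 2 \<le> ln (real N)" using N by simp
    then show ?thesis using ln2_ge_two_thirds by linarith
  qed
  have "\<sigma> * (n * (1 / 2)) \<le> Kl * ln N"
    using mult_mono[OF Kl lnN] Kl_pos by (simp add: mult_ac)
  also have "\<dots> \<le> (1 + r) * Kl * ln N" using r Kl_pos lnN by simp
  also have "\<dots> \<le> N * \<sigma> * cdelta \<delta>" by (rule sample_size')
  also have "\<dots> \<le> N * \<sigma> * (1 / 8)" using sigma_ge_1 cdelta_le_eighth by (intro mult_left_mono) auto
  finally have "\<sigma> * (n * (1 / 2)) \<le> \<sigma> * (N * (1 / 8))" by (simp add: mult_ac)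
  then have "real n * (1 / 2) \<le> N * (1 / 8)"
    using sigma_ge_1 by (subst (asm) mult_le_cancel_left_pos) auto
  then show ?thesis by linarith
qed

text \<open>The reason for the choice of \<delta>: a relative loss \<delta> of \<sigma> is an
  absolute loss of at most 1/2.\<close>

lemma stability_gap: "1 / 2 + lam * mmin \<le> (1 - \<delta>) * \<sigma>"
  using sigma_delta by (simp add: algebra_simps)

text \<open>The choice s = - ln (1 - \<delta>) / Kl optimizes the exponential bound at the threshold
  N (1 - \<delta>) \<sigma>, with exp (- s Kl) = 1 - \<delta>. The exponent is then the lower tail
  one times - N \<sigma> / Kl, the sample size condition turns it into N^(-1-r), and 2 n \<le> N / 2
  uses up one power of N.\<close>

lemma tail_bound:
  "2 * n * exp ((- ln (1 - \<delta>) / Kl) * (N * ((1 - \<delta>) * \<sigma>)))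
      * (1 - (1 - exp (- ((- ln (1 - \<delta>) / Kl) * Kl))) / Kl * \<sigma>) ^ N \<le> N powr (- r) / 2"
proof -
  note K = Kl_pos
  have d: "0 < \<delta>" "\<delta> < 1" "\<delta> \<le> 1" using delta_bounds by simp_all
  have e: "exp (- ((- ln (1 - \<delta>) / Kl) * Kl)) = 1 - \<delta>" using K d by simp
  have x1: "\<delta> / Kl * \<sigma> \<le> 1"
    using K d sigma_ge_1 mult_mono[of \<delta> 1 \<sigma> Kl] by (simp add: field_simps)
  have "(1 - \<delta> / Kl * \<sigma>) ^ N \<le> exp (- (\<delta> / Kl * \<sigma>)) ^ N"
    using x1 exp_ge_add_one_self[of "- (\<delta> / Kl * \<sigma>)"] by (intro power_mono) auto
  also have "\<dots> = exp (N * - (\<delta> / Kl * \<sigma>))" by (rule exp_of_nat_mult[symmetric])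
  finally have "exp ((- ln (1 - \<delta>) / Kl) * (N * ((1 - \<delta>) * \<sigma>))) * (1 - \<delta> / Kl * \<sigma>) ^ N
    \<le> exp ((- ln (1 - \<delta>) / Kl) * (N * ((1 - \<delta>) * \<sigma>))) * exp (N * - (\<delta> / Kl * \<sigma>))"
    by (intro mult_left_mono) auto
  also have "\<dots> = exp (- (N * \<sigma> / Kl * ((1 - \<delta>) * ln (1 - \<delta>) + \<delta>)))"
    unfolding exp_add[symmetric] using K by (intro arg_cong[where f=exp]) (simp add: field_simps)
  also have "\<dots> \<le> exp (- (N * \<sigma> / Kl * cdelta \<delta>))"
  proof -
    have "N * \<sigma> / Kl * cdelta \<delta> \<le> N * \<sigma> / Kl * ((1 - \<delta>) * ln (1 - \<delta>) + \<delta>)"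
      using K sigma_ge_1 cdelta_le_lower_tail[of \<delta>] d by (intro mult_left_mono) auto
    then show ?thesis by simp
  qed
  also have "\<dots> \<le> exp (- ((1 + r) * ln N))"
    using sample_size' K by (simp add: field_simps)
  also have "\<dots> = N powr (- (1 + r))" using N by (simp add: powr_def algebra_simps)
  finally have "exp ((- ln (1 - \<delta>) / Kl) * (N * ((1 - \<delta>) * \<sigma>))) * (1 - \<delta> / Kl * \<sigma>) ^ N
    \<le> N powr (- (1 + r))" .
  then have "2 * n * (exp ((- ln (1 - \<delta>) / Kl) * (N * ((1 - \<delta>) * \<sigma>))) * (1 - \<delta> / Kl * \<sigma>) ^ N)
    \<le> 2 * n * N powr (- (1 + r))"
    by (intro mult_left_mono) auto
  also have "\<dots> \<le> (N / 2) * N powr (- (1 + r))"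
    using four_n_le by (intro mult_right_mono) auto
  also have "\<dots> = N powr (- r) / 2"
  proof -
    have "N * N powr (- (1 + r)) = N powr (1 + - (1 + r))"
      using N by (subst powr_add) simp
    then show ?thesis by simp
  qed
  finally show ?thesis unfolding e by (simp add: mult.assoc)
qed

text \<open>Monotonicity of cdelta x / x gives \<open>cdelta \<delta>\<close> \<le> 2 \<delta>
  \<open>cdelta (1 / 2)\<close>, and \<sigma> \<delta> \<le> 1/2 then removes \<sigma> and \<delta>
  from the condition. It controls the variance of the empirical inner products.\<close>

lemma Kl_over_N: "Kl / N \<le> cdelta (1 / 2) / (ln N * (1 + r))"
proof -
  have "cdelta \<delta> / \<delta> \<le> cdelta (1 / 2) / (1 / 2)"
    using delta_bounds by (intro cdelta_div_mono)
  then have "cdelta \<delta> \<le> \<delta> * (2 * cdelta (1 / 2))"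
    using delta_bounds by (simp add: divide_le_eq mult_ac)
  then have "\<sigma> * cdelta \<delta> \<le> \<sigma> * (\<delta> * (2 * cdelta (1 / 2)))"
    using sigma_ge_1 by (intro mult_left_mono) auto
  also have "\<dots> = (\<sigma> * \<delta>) * (2 * cdelta (1 / 2))" by (simp only: mult.assoc)
  also have "\<dots> \<le> (1 / 2) * (2 * cdelta (1 / 2))"
    using sigma_delta cdelta_pos[of "1/2"] by (intro mult_right_mono) auto
  finally have s: "\<sigma> * cdelta \<delta> \<le> cdelta (1 / 2)" by simp
  have "(1 + r) * Kl * ln N \<le> N * (\<sigma> * cdelta \<delta>)" using sample_size' by (simp only: mult.assoc)
  also have "\<dots> \<le> N * cdelta (1 / 2)" using s by (intro mult_left_mono) auto
  finally have le: "Kl * (ln N * (1 + r)) \<le> cdelta (1 / 2) * N" by (simp add: mult_ac)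
  have "0 < ln (real N) * (1 + r)" "0 < real N" using N r by simp_all
  with le show ?thesis by (simp add: divide_le_eq le_divide_eq)
qed

text \<open>If x is this factor, x \<le> 1/2 gives e (1 + 4 x) \<le> 2 e (1 + x) in the final
  estimate. The bound 4 n \<le> N provides N \<ge> 4 and hence ln N \<ge> 1.\<close>

lemma variance_factor_le_half:
  "cdelta (1 / 2) / (ln N * (1 + r) * (1 / 2 + lam * mmin)\<^sup>2) \<le> 1 / 2"
proof -
  have "4 \<le> real N" using four_n_le n by linarith
  have "1 \<le> ln (real N)"
  proof -
    have "ln (2 ^ 2) \<le> ln (real N)" using \<open>4 \<le> real N\<close> by simp
    then show ?thesis using ln2_ge_two_thirds ln_realpow[of 2 2] by simp
  qed
  then have "1 * 1 \<le> ln N * (1 + r)" using r by (intro mult_mono) auto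
  moreover have "(1 / 2)\<^sup>2 \<le> (1 / 2 + lam * mmin)\<^sup>2" using lam m by (intro power_mono) auto
  ultimately have "1 * (1 / 2)\<^sup>2 \<le> (ln N * (1 + r)) * (1 / 2 + lam * mmin)\<^sup>2"
    by (intro mult_mono) auto
  then have "cdelta (1 / 2) \<le> 1 / 2 * ((ln N * (1 + r)) * (1 / 2 + lam * mmin)\<^sup>2)"
    using cdelta_le_eighth(2) by (simp add: power2_eq_square)
  then show ?thesis
    using \<open>1 * (1 / 2)\<^sup>2 \<le> (ln N * (1 + r)) * (1 / 2 + lam * mmin)\<^sup>2\<close>
    by (simp add: divide_le_eq power2_eq_square) 
qed

end

section \<open>Regularized least squares\<close>

lemma integral_PiM_component:
  fixes f :: "'b \<Rightarrow> real"
  assumes "prob_space p" "l < N" "f \<in> borel_measurable p"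
  shows "(\<integral>\<omega>. f (\<omega> l) \<partial>PiM {..<N} (\<lambda>_. p)) = (\<integral>x. f x \<partial>p)"
proof -
  have "(\<integral>x. f x \<partial>p) = (\<integral>x. f x \<partial>distr (PiM {..<N} (\<lambda>_. p)) p (\<lambda>\<omega>. \<omega> l))"
    using distr_PiM_component[of "{..<N}" "\<lambda>_. p" l] assms by simp
  also have "\<dots> = (\<integral>\<omega>. f (\<omega> l) \<partial>PiM {..<N} (\<lambda>_. p))"
    using assms by (intro integral_distr) auto
  finally show ?thesis by simp
qed

text \<open>When the last sample is integrated out, the cross term vanishes because the mean is 0,
  so second moments add.\<close>

lemma integral_PiM_sum_sq:
  fixes N :: nat
  assumes p: "prob_space p" and f: "bounded_measurable p f" and mean: "(\<integral>x. f x \<partial>p) = 0"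
  shows "(\<integral>\<omega>. (\<Sum>l<N. f (\<omega> l))\<^sup>2 \<partial>PiM {..<N} (\<lambda>_. p)) = N * (\<integral>x. (f x)\<^sup>2 \<partial>p)"
proof (induction N)
  case (Suc N)
  interpret p: prob_space p by (rule p)
  interpret PN: prob_space "PiM {..<N} (\<lambda>_. p)" by (intro prob_space_PiM p)
  interpret PS: prob_space "PiM {..<Suc N} (\<lambda>_. p)" by (intro prob_space_PiM p)
  have bm: "bounded_measurable (PiM {..<M} (\<lambda>_. p)) (\<lambda>\<omega>. (\<Sum>l<M. f (\<omega> l))\<^sup>2)" for M
    by (intro bounded_measurable_intros bounded_measurable_compose[OF f]) auto
  have int: "integrable p f" "integrable p (\<lambda>x. (f x)\<^sup>2)"
    by (intro p.integrable_bounded_measurable bounded_measurable_intros f)+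
  have "(\<integral>\<omega>. (\<Sum>l<Suc N. f (\<omega> l))\<^sup>2 \<partial>PiM {..<Suc N} (\<lambda>_. p))
    = (\<integral>\<omega>. (\<integral>x. (\<Sum>l<Suc N. f (fun_upd \<omega> N x l))\<^sup>2 \<partial>p) \<partial>PiM {..<N} (\<lambda>_. p))"
    by (intro integral_PiM_lessThan_Suc p PS.integrable_bounded_measurable bm)
  also have "\<dots> = (\<integral>\<omega>. (\<Sum>l<N. f (\<omega> l))\<^sup>2 + (\<integral>x. (f x)\<^sup>2 \<partial>p) \<partial>PiM {..<N} (\<lambda>_. p))"
  proof (intro Bochner_Integration.integral_cong refl)
    fix \<omega>
    define s where "s = (\<Sum>l<N. f (\<omega> l))"
    have "(\<integral>x. (\<Sum>l<Suc N. f (fun_upd \<omega> N x l))\<^sup>2 \<partial>p) = (\<integral>x. s\<^sup>2 + 2 * s * f x + (f x)\<^sup>2 \<partial>p)"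
      by (simp add: s_def power2_sum algebra_simps)
    also have "\<dots> = s\<^sup>2 + (\<integral>x. (f x)\<^sup>2 \<partial>p)"
      using int mean by (simp add: p.prob_space)
    finally show "(\<integral>x. (\<Sum>l<Suc N. f (fun_upd \<omega> N x l))\<^sup>2 \<partial>p) = (\<Sum>l<N. f (\<omega> l))\<^sup>2 + (\<integral>x. (f x)\<^sup>2 \<partial>p)"
      by (simp add: s_def)
  qed
  also have "\<dots> = N * (\<integral>x. (f x)\<^sup>2 \<partial>p) + (\<integral>x. (f x)\<^sup>2 \<partial>p)"
    using PN.integrable_bounded_measurable[OF bm] Suc.IH by (simp add: PN.prob_space)
  finally show ?case by (simp add: algebra_simps)
qed simp

text \<open>Cauchy-Schwarz for the form gives |A_ij| \<le> sqrt (A_ii A_jj), and Cauchy-Schwarz for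
  sums then produces the trace. This replaces comparing the largest eigenvalue with the sum of all
  eigenvalues.\<close>

lemma psd_quad_le_mat_trace:
  assumes "mat_transpose A = A" and psd: "\<And>v. 0 \<le> dotp n v (mat_vec n A v)"
  shows "dotp n v (mat_vec n A v) \<le> mat_trace n A * dotp n v v"
proof -
  define e where "e l = (\<lambda>a. if a = l then 1 else 0 :: real)" for l :: nat
  have e: "dotp n (e l) v = v l" if "l < n" for l v
    using that by (simp add: dotp_def e_def if_distrib[of "\<lambda>x. x * _"] sum.delta cong: if_cong)
  have "mat_vec n A (e j) i = A i j" if "j < n" for i j
    using that by (simp add: mat_vec_def e_def if_distrib[of "\<lambda>x. _ * x"] sum.delta cong: if_cong)
  then have ent: "dotp n (e i) (mat_vec n A (e j)) = A i j" if "i < n" "j < n" for i j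
    using that by (simp add: e)
  have diag: "0 \<le> A i i" if "i < n" for i using psd[of "e i"] ent that by simp
  have entry: "A i j * (v i * v j) \<le> (\<bar>v i\<bar> * sqrt (A i i)) * (\<bar>v j\<bar> * sqrt (A j j))"
    if "i < n" "j < n" for i j
  proof -
    have "(A i j)\<^sup>2 \<le> A i i * A j j"
      using psd_Cauchy_Schwarz[OF assms, of "e i" "e j"] that by (simp add: ent)
    then have "\<bar>A i j\<bar> \<le> sqrt (A i i) * sqrt (A j j)"
      by (metis real_sqrt_abs real_sqrt_le_mono real_sqrt_mult)
    then have "\<bar>A i j\<bar> * \<bar>v i * v j\<bar> \<le> sqrt (A i i) * sqrt (A j j) * \<bar>v i * v j\<bar>"
      by (rule mult_right_mono) simp
    then show ?thesis
      using abs_ge_self[of "A i j * (v i * v j)"] by (simp add: abs_mult mult_ac)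
  qed
  have "dotp n v (mat_vec n A v) = (\<Sum>i<n. \<Sum>j<n. A i j * (v i * v j))"
    by (simp add: dotp_def mat_vec_def sum_distrib_left mult_ac)
  also have "\<dots> \<le> (\<Sum>i<n. \<Sum>j<n. (\<bar>v i\<bar> * sqrt (A i i)) * (\<bar>v j\<bar> * sqrt (A j j)))"
    by (intro sum_mono entry) auto
  also have "\<dots> = (\<Sum>i<n. \<bar>v i\<bar> * sqrt (A i i))\<^sup>2"
    by (simp add: power2_eq_square sum_product)
  also have "\<dots> \<le> (\<Sum>i<n. \<bar>v i\<bar>\<^sup>2) * (\<Sum>i<n. (sqrt (A i i))\<^sup>2)"
    by (rule Cauchy_Schwarz_ineq_sum)
  also have "\<dots> = mat_trace n A * dotp n v v"
    using diag by (simp add: mat_trace_def dotp_def power2_eq_square mult.commute)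
  finally show ?thesis .
qed

lemma quadratic_minimum_derivative:
  fixes a b :: real
  assumes "\<And>t. 0 \<le> a * t\<^sup>2 + b * t" shows "b = 0"
proof (rule ccontr)
  assume b: "b \<noteq> 0"
  \<comment> \<open>At t = -u the linear term is - (|a| + 1) u^2, which outweighs a u^2 for either
    sign of \<open>a\<close>.\<close>
  define u where "u = b / (\<bar>a\<bar> + 1)"
  have u: "b = (\<bar>a\<bar> + 1) * u" "u \<noteq> 0" using b by (simp_all add: u_def)
  have "a * (- u)\<^sup>2 + b * (- u) = (a - \<bar>a\<bar> - 1) * u\<^sup>2"
    by (simp add: u(1) power2_eq_square algebra_simps)
  also have "\<dots> < 0" using u(2) by (intro mult_neg_pos) auto
  finally show False using assms[of "- u"] by simp
qed

section \<open>Error of the minimizer for a fixed sample\<close>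

context
  fixes n N :: nat and L :: "nat \<Rightarrow> nat \<Rightarrow> real" and B :: "nat \<Rightarrow> rmat"
    and y :: "nat \<Rightarrow> real" and lam :: real
  assumes symB: "\<And>l. l < N \<Longrightarrow> mat_transpose (B l) = B l"
    and psdB: "\<And>l v. l < N \<Longrightarrow> 0 \<le> dotp n v (mat_vec n (B l) v)"
    and lam: "0 \<le> lam" and N: "0 < N"
begin

abbreviation (input) "cost c \<equiv> (\<Sum>l<N. (y l - dotp n c (L l))\<^sup>2) / N
  + lam * ((\<Sum>l<N. dotp n c (mat_vec n (B l) c)) / N)"

text \<open>Along c + t v the cost is a quadratic polynomial in t with minimum at t = 0, so its
  linear coefficient vanishes.\<close>

lemma normal_equation:
  assumes "\<And>c'. cost c \<le> cost c'"
  shows "(\<Sum>l<N. (y l - dotp n c (L l)) * dotp n v (L l)) = lam * (\<Sum>l<N. dotp n v (mat_vec n (B l) c))"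
proof -
  define a where "a = (\<Sum>l<N. (dotp n v (L l))\<^sup>2) + lam * (\<Sum>l<N. dotp n v (mat_vec n (B l) v))"
  define b where "b = - 2 * (\<Sum>l<N. (y l - dotp n c (L l)) * dotp n v (L l))
    + 2 * lam * (\<Sum>l<N. dotp n v (mat_vec n (B l) c))"
  have "0 \<le> a * t\<^sup>2 + b * t" for t
  proof -
    let ?c = "\<lambda>i. c i + t * v i"
    have "(\<Sum>l<N. (y l - dotp n ?c (L l))\<^sup>2) = (\<Sum>l<N. (y l - dotp n c (L l))\<^sup>2
        - 2 * t * ((y l - dotp n c (L l)) * dotp n v (L l)) + t\<^sup>2 * (dotp n v (L l))\<^sup>2)"
      by (intro sum.cong) (simp_all add: dotp_linear power2_eq_square algebra_simps)
    also have "\<dots> = (\<Sum>l<N. (y l - dotp n c (L l))\<^sup>2)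
        - 2 * t * (\<Sum>l<N. (y l - dotp n c (L l)) * dotp n v (L l)) + t\<^sup>2 * (\<Sum>l<N. (dotp n v (L l))\<^sup>2)"
      by (simp add: sum.distrib sum_subtractf sum_distrib_left)
    finally have 1: "(\<Sum>l<N. (y l - dotp n ?c (L l))\<^sup>2) = \<dots>" .
    have "(\<Sum>l<N. dotp n ?c (mat_vec n (B l) ?c)) = (\<Sum>l<N. dotp n c (mat_vec n (B l) c)
        + 2 * t * dotp n v (mat_vec n (B l) c) + t\<^sup>2 * dotp n v (mat_vec n (B l) v))"
    proof (intro sum.cong refl)
      fix l assume "l \<in> {..<N}"
      then have "dotp n c (mat_vec n (B l) v) = dotp n v (mat_vec n (B l) c)"
        using symB by (intro dotp_mat_vec_commute) auto
      then show "dotp n ?c (mat_vec n (B l) ?c) = dotp n c (mat_vec n (B l) c)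
        + 2 * t * dotp n v (mat_vec n (B l) c) + t\<^sup>2 * dotp n v (mat_vec n (B l) v)"
        by (simp add: dotp_linear mat_vec_add mat_vec_scale power2_eq_square algebra_simps)
    qed
    also have "\<dots> = (\<Sum>l<N. dotp n c (mat_vec n (B l) c))
        + 2 * t * (\<Sum>l<N. dotp n v (mat_vec n (B l) c)) + t\<^sup>2 * (\<Sum>l<N. dotp n v (mat_vec n (B l) v))"
      by (simp add: sum.distrib sum_distrib_left)
    finally have 2: "(\<Sum>l<N. dotp n ?c (mat_vec n (B l) ?c)) = \<dots>" .
    have "(\<Sum>l<N. (y l - dotp n c (L l))\<^sup>2) + lam * (\<Sum>l<N. dotp n c (mat_vec n (B l) c))
      \<le> (\<Sum>l<N. (y l - dotp n ?c (L l))\<^sup>2) + lam * (\<Sum>l<N. dotp n ?c (mat_vec n (B l) ?c))"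
      using assms[of ?c] N
      by (simp only: times_divide_eq_right add_divide_distrib[symmetric] divide_le_cancel)
    then show ?thesis unfolding 1 2 a_def b_def by (simp add: algebra_simps)
  qed
  then have "b = 0" by (rule quadratic_minimum_derivative)
  then show ?thesis by (simp add: b_def)
qed

text \<open>Testing the normal equation with the error \<open>z\<close> itself expresses its
  regularized empirical energy \<open>q\<close> through the residual correlations \<open>b\<close>
  and a cross energy with \<open>w\<close>. AM-GM absorbs half of each, and \<open>stable\<close>
  bounds \<open>q\<close> below.\<close>

lemma regression_error_le:
  fixes w :: "nat \<Rightarrow> real" and \<kappa> :: real
  assumes min: "\<And>c'. cost c \<le> cost c'"
    and \<kappa>: "1 / 2 \<le> \<kappa>"
    and stable: "\<And>v. \<kappa> * N * dotp n v v \<le> (\<Sum>l<N. (dotp n v (L l))\<^sup>2 + lam * dotp n v (mat_vec n (B l) v))"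
  defines "z \<equiv> \<lambda>i. c i - w i"
    and "b \<equiv> \<lambda>i. (\<Sum>l<N. (y l - dotp n w (L l)) * L l i) / N"
  shows "dotp n z z \<le> 4 * dotp n b b / \<kappa>\<^sup>2 + 4 * lam * ((\<Sum>l<N. dotp n w (mat_vec n (B l) w)) / N)"
proof -
  define q where "q = (\<Sum>l<N. (dotp n z (L l))\<^sup>2 + lam * dotp n z (mat_vec n (B l) z))"
  define W where "W = (\<Sum>l<N. dotp n w (mat_vec n (B l) w))"
  have c: "dotp n c u = dotp n w u + dotp n z u" "mat_vec n A c = (\<lambda>i. mat_vec n A w i + mat_vec n A z i)" for u A
    by (simp_all add: z_def dotp_linear mat_vec_diff)
  have \<kappa>0: "0 < \<kappa>" using \<kappa> by simp
  have lin: "(\<Sum>l<N. (y l - dotp n w (L l)) * dotp n z (L l)) = N * dotp n z b"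
  proof -
    have "(\<Sum>l<N. (y l - dotp n w (L l)) * dotp n z (L l))
        = (\<Sum>l<N. \<Sum>i<n. z i * ((y l - dotp n w (L l)) * L l i))"
      unfolding dotp_def[of n z] by (simp add: sum_distrib_left mult_ac)
    also have "\<dots> = (\<Sum>i<n. z i * (\<Sum>l<N. (y l - dotp n w (L l)) * L l i))"
      by (subst sum.swap) (simp add: sum_distrib_left)
    also have "\<dots> = (\<Sum>i<n. N * (z i * b i))"
      using N by (intro sum.cong) (simp_all add: b_def)
    also have "\<dots> = N * dotp n z b"
      by (simp add: dotp_def sum_distrib_left)
    finally show ?thesis .
  qed
  have "(\<Sum>l<N. (y l - dotp n c (L l)) * dotp n z (L l))
      = (\<Sum>l<N. (y l - dotp n w (L l)) * dotp n z (L l)) - (\<Sum>l<N. (dotp n z (L l))\<^sup>2)"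
    unfolding sum_subtractf[symmetric]
    by (intro sum.cong) (simp_all add: c power2_eq_square algebra_simps)
  moreover have "(\<Sum>l<N. dotp n z (mat_vec n (B l) c))
      = (\<Sum>l<N. dotp n z (mat_vec n (B l) w)) + (\<Sum>l<N. dotp n z (mat_vec n (B l) z))"
    by (simp add: c dotp_linear sum.distrib)
  ultimately have eq: "q = N * dotp n z b - lam * (\<Sum>l<N. dotp n z (mat_vec n (B l) w))"
    using normal_equation[OF min, of z] lin
    by (simp add: q_def sum.distrib sum_distrib_left[symmetric] algebra_simps)
  \<comment> \<open>Semidefiniteness of \<open>B l\<close> at z + w is AM-GM for the energies; the
    part belonging to \<open>z\<close> is absorbed by q / 2.\<close>
  have "- (\<Sum>l<N. dotp n z (mat_vec n (B l) w))
      \<le> (\<Sum>l<N. (dotp n z (mat_vec n (B l) z) + dotp n w (mat_vec n (B l) w)) / 2)"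
    unfolding sum_negf[symmetric]
  proof (intro sum_mono)
    fix l assume l: "l \<in> {..<N}"
    have "dotp n w (mat_vec n (B l) z) = dotp n z (mat_vec n (B l) w)"
      using l symB by (intro dotp_mat_vec_commute) auto
    then show "- dotp n z (mat_vec n (B l) w) \<le> (dotp n z (mat_vec n (B l) z) + dotp n w (mat_vec n (B l) w)) / 2"
      using l psdB[of l "\<lambda>i. z i + w i"] by (simp add: dotp_linear mat_vec_add)
  qed
  also have "\<dots> = ((\<Sum>l<N. dotp n z (mat_vec n (B l) z)) + W) / 2"
    by (simp add: W_def sum.distrib add_divide_distrib sum_divide_distrib)
  finally have "lam * - (\<Sum>l<N. dotp n z (mat_vec n (B l) w))
      \<le> lam * (((\<Sum>l<N. dotp n z (mat_vec n (B l) z)) + W) / 2)"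
    using lam by (rule mult_left_mono)
  also have "\<dots> \<le> (q + lam * W) / 2"
    by (simp add: q_def sum.distrib sum_distrib_left[symmetric] algebra_simps sum_nonneg)
  finally have cross: "q \<le> N * dotp n z b + (q + lam * W) / 2" using eq by simp
  \<comment> \<open>The weights are chosen so that the term in \<open>b\<close> consumes half of
    \<kappa> N |z|^2.\<close>
  have "0 \<le> dotp n (\<lambda>i. \<kappa> * z i - 2 * b i) (\<lambda>i. \<kappa> * z i - 2 * b i)" by (rule dotp_self_nonneg)
  also have "\<dots> = \<kappa>\<^sup>2 * dotp n z z - 4 * \<kappa> * dotp n z b + 4 * dotp n b b"
    unfolding dotp_linear by (simp add: dotp_commute[of n b z] power2_eq_square algebra_simps)
  finally have "\<kappa> * (4 * dotp n z b) \<le> \<kappa> * (\<kappa> * dotp n z z + 4 * dotp n b b / \<kappa>)"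
    using \<kappa>0 by (simp add: power2_eq_square algebra_simps)
  define D where "D = 4 * dotp n b b / \<kappa>"
  have amgm: "4 * dotp n z b \<le> \<kappa> * dotp n z z + D"
    using \<open>\<kappa> * (4 * dotp n z b) \<le> _\<close> \<kappa>0 by (simp add: D_def)
  have "q \<le> 2 * (N * dotp n z b) + lam * W"
    using cross by (simp add: field_simps)
  with stable[of z, folded q_def] have "\<kappa> * N * dotp n z z \<le> 2 * (N * dotp n z b) + lam * W"
    by (rule order_trans)
  also have "2 * (N * dotp n z b) \<le> N * ((\<kappa> * dotp n z z + D) / 2)"
    using mult_left_mono[OF amgm, of "real N"] by simp
  finally have "N * (\<kappa> * dotp n z z) \<le> N * D + 2 * lam * W"
    by (simp add: field_simps)
  also have "\<dots> = N * (4 * dotp n b b / \<kappa> + 2 * lam * (W / N))"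
    using N by (simp add: D_def distrib_left)
  finally have "\<kappa> * dotp n z z \<le> 4 * dotp n b b / \<kappa> + 2 * lam * (W / N)"
    using N by simp
  then have "dotp n z z \<le> (4 * dotp n b b / \<kappa> + 2 * lam * (W / N)) / \<kappa>"
    using \<kappa>0 by (simp add: field_simps)
  also have "\<dots> = 4 * dotp n b b / \<kappa>\<^sup>2 + 2 * lam * (W / N) / \<kappa>"
    by (simp add: add_divide_distrib power2_eq_square)
  also have "2 * lam * (W / N) / \<kappa> \<le> 2 * lam * (W / N) / (1 / 2)"
  proof (rule divide_left_mono)
    have "0 \<le> W" unfolding W_def by (intro sum_nonneg psdB) auto
    then show "0 \<le> 2 * lam * (W / N)" using lam by simp
  qed (use \<kappa> in auto)
  finally show ?thesis by (simp add: W_def)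
qed

end

section \<open>Expected risk of the clipped estimator\<close>

lemma clip_sq_le:
  fixes a b M :: real
  assumes "\<bar>a\<bar> \<le> M"
  shows "(a - max (- M) (min b M))\<^sup>2 \<le> (a - b)\<^sup>2"
    and "(a - max (- M) (min b M))\<^sup>2 \<le> 4 * M\<^sup>2"
proof -
  show "(a - max (- M) (min b M))\<^sup>2 \<le> (a - b)\<^sup>2"
    unfolding abs_le_square_iff[symmetric] using assms by (auto simp: max_def min_def)
  have "(a - max (- M) (min b M))\<^sup>2 \<le> (2 * M)\<^sup>2"
    unfolding abs_le_square_iff[symmetric] using assms by (auto simp: max_def min_def)
  then show "(a - max (- M) (min b M))\<^sup>2 \<le> 4 * M\<^sup>2" by (simp add: power2_eq_square)
qed

text \<open>The estimate on an arbitrary probability space: only the evaluations \<open>L\<close> of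
  the basis and the energy matrices \<open>B\<close> enter, which separates it from calculus on
  spaces of measures.\<close>

theorem regularized_least_squares_risk:
  fixes p :: "'b measure" and n N :: nat and L :: "'b \<Rightarrow> nat \<Rightarrow> real" and B :: "'b \<Rightarrow> rmat"
    and F :: "'b \<Rightarrow> real" and S :: "(nat \<Rightarrow> 'b) \<Rightarrow> nat \<Rightarrow> real" and m :: "nat \<Rightarrow> real"
    and lam r M Kl mmin mmax :: real
  assumes p: "prob_space p" and lam: "0 \<le> lam" and n: "1 \<le> n" and r: "0 < r" and N: "2 \<le> N"
    and L: "\<And>i. i < n \<Longrightarrow> bounded_measurable p (\<lambda>x. L x i)"
    and B: "\<And>i j. i < n \<Longrightarrow> j < n \<Longrightarrow> bounded_measurable p (\<lambda>x. B x i j)"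
    and symB: "\<And>x. x \<in> space p \<Longrightarrow> mat_transpose (B x) = B x"
    and psdB: "\<And>x v. x \<in> space p \<Longrightarrow> 0 \<le> dotp n v (mat_vec n (B x) v)"
    and orth: "\<And>i j. i < n \<Longrightarrow> j < n \<Longrightarrow> (\<integral>x. L x i * L x j \<partial>p) = (if i = j then 1 else 0)"
    and meanB: "\<And>i j. i < n \<Longrightarrow> j < n \<Longrightarrow> (\<integral>x. B x i j \<partial>p) = (if i = j then m i else 0)"
    and m: "0 \<le> mmin" "mmin \<le> mmax" "\<And>i. i < n \<Longrightarrow> mmin \<le> m i"
    and Kl: "\<And>x. x \<in> space p \<Longrightarrow> (\<Sum>i<n. (L x i)\<^sup>2 + lam * B x i i) \<le> Kl"
    and F: "F \<in> borel_measurable p" "\<And>x. x \<in> space p \<Longrightarrow> \<bar>F x\<bar> \<le> M"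
    and S_min: "\<And>\<omega> c. \<omega> \<in> space (PiM {..<N} (\<lambda>_. p)) \<Longrightarrow>
      (\<Sum>l<N. (F (\<omega> l) - dotp n (S \<omega>) (L (\<omega> l)))\<^sup>2) / N
        + lam * ((\<Sum>l<N. dotp n (S \<omega>) (mat_vec n (B (\<omega> l)) (S \<omega>))) / N)
      \<le> (\<Sum>l<N. (F (\<omega> l) - dotp n c (L (\<omega> l)))\<^sup>2) / N
        + lam * ((\<Sum>l<N. dotp n c (mat_vec n (B (\<omega> l)) c)) / N)"
    and sample_size: "real N / ln (real N)
        \<ge> (1 + r) * Kl / ((1 + lam * mmin) * cdelta (1 / (2 * (1 + lam * mmax))))"
  defines "w \<equiv> \<lambda>i. \<integral>x. F x * L x i \<partial>p"
  defines "e \<equiv> \<integral>x. (F x - dotp n w (L x))\<^sup>2 \<partial>p"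
  shows "(\<integral>\<omega>. (\<integral>x. (F x - max (- M) (min (dotp n (S \<omega>) (L x)) M))\<^sup>2 \<partial>p) \<partial>PiM {..<N} (\<lambda>_. p))
    \<le> 2 * e * (1 + cdelta (1 / 2) / (ln N * (1 + r) * (1 / 2 + lam * mmin)\<^sup>2))
      + 4 * lam * (\<integral>x. dotp n w (mat_vec n (B x) w) \<partial>p) + 2 * M\<^sup>2 * N powr (- r)"
proof -
  interpret p: prob_space p by (rule p)
  interpret PN: prob_space "PiM {..<N} (\<lambda>_. p)" by (intro prob_space_PiM p)
  define \<delta> where "\<delta> = 1 / (2 * (1 + lam * mmax))"
  define \<sigma> where "\<sigma> = 1 + lam * mmin"
  define \<kappa> where "\<kappa> = 1 / 2 + lam * mmin"
  define X where "X x = (\<lambda>i j. L x i * L x j + lam * B x i j)" for x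
  define g where "g x = F x - dotp n w (L x)" for x
  have Fb: "bounded_measurable p F" using F by (intro bounded_measurableI)
  have ipL: "bounded_measurable p (\<lambda>x. dotp n v (L x))" for v
    unfolding dotp_def by (intro bounded_measurable_intros L) auto
  have gb: "bounded_measurable p g"
    unfolding g_def by (intro bounded_measurable_intros Fb ipL)
  have qBb: "bounded_measurable p (\<lambda>x. dotp n v (mat_vec n (B x) v))" for v
    unfolding dotp_def mat_vec_def by (intro bounded_measurable_intros B) auto
  have Xb: "bounded_measurable p (\<lambda>x. X x i j)" if "i < n" "j < n" for i j
    unfolding X_def using that by (intro bounded_measurable_intros L B) auto
  have intg: "integrable p f" if "bounded_measurable p f" for f :: "'b \<Rightarrow> real"
    using that by (rule p.integrable_bounded_measurable)
  have quadX: "dotp n v (mat_vec n (X x) v) = (dotp n v (L x))\<^sup>2 + lam * dotp n v (mat_vec n (B x) v)" for v x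
  proof -
    have "mat_vec n (X x) v = (\<lambda>i. dotp n v (L x) * L x i + lam * mat_vec n (B x) v i)"
      unfolding X_def mat_vec_def dotp_def
      by (simp add: algebra_simps sum.distrib sum_distrib_left)
    then show ?thesis by (simp add: dotp_linear power2_eq_square)
  qed
  have symX: "mat_transpose (X x) = X x" if "x \<in> space p" for x
    using symB[OF that] by (auto simp: mat_transpose_def X_def fun_eq_iff mult.commute)
  have psdX: "0 \<le> dotp n v (mat_vec n (X x) v)" if "x \<in> space p" for x v
    unfolding quadX using psdB[OF that] lam by simp
  have trX: "mat_trace n (X x) \<le> Kl" if "x \<in> space p" for x
    using Kl[OF that] by (simp add: mat_trace_def X_def power2_eq_square)
  have leX: "dotp n v (mat_vec n (X x) v) \<le> Kl * dotp n v v" if "x \<in> space p" for x v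
    using psd_quad_le_mat_trace[OF symX[OF that] psdX[OF that], of v]
      mult_right_mono[OF trX[OF that] dotp_self_nonneg[of n v]] by simp
  have meanX: "(\<integral>x. X x i j \<partial>p) = (if i = j then 1 + lam * m i else 0)" if "i < n" "j < n" for i j
    unfolding X_def using that orth[OF that] meanB[OF that]
    by (subst Bochner_Integration.integral_add)
      (auto intro!: intg bounded_measurable_intros L B)
  \<comment> \<open>The mean of \<open>X\<close> has diagonal entries 1 + lam m_i, while its trace
    is a mean of traces bounded by \<open>Kl\<close>.\<close>
  have nKl: "n * (1 + lam * mmin) \<le> Kl"
  proof -
    have "(\<Sum>i<n. 1 + lam * mmin) \<le> (\<Sum>i<n. 1 + lam * m i)"
      using m lam by (intro sum_mono) (auto intro: mult_left_mono)
    also have "\<dots> = (\<Sum>i<n. \<integral>x. X x i i \<partial>p)" by (simp add: meanX)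
    also have "\<dots> = (\<integral>x. mat_trace n (X x) \<partial>p)"
      unfolding mat_trace_def by (rule Bochner_Integration.integral_sum[symmetric]) (auto intro!: intg Xb)
    also have "\<dots> \<le> (\<integral>x. Kl \<partial>p)"
      by (intro integral_mono intg bounded_measurable_mat_trace bounded_measurable_const Xb trX)
    finally show ?thesis by (simp add: p.prob_space)
  qed
  note num = lam r m(1,2) n N \<delta>_def nKl sample_size[folded \<delta>_def]
  have \<sigma>1: "1 \<le> \<sigma>" and Kl0: "0 < Kl" and \<sigma>Kl: "\<sigma> \<le> Kl"
    using sigma_ge_1[OF num] Kl_pos[OF num] by (simp_all add: \<sigma>_def)
  have \<delta>: "0 < \<delta>" "\<delta> \<le> 1 / 2" using delta_bounds[OF num] by simp_all
  have gap: "\<kappa> \<le> (1 - \<delta>) * \<sigma>" using stability_gap[OF num] by (simp add: \<kappa>_def \<sigma>_def)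
  have \<kappa>: "1 / 2 \<le> \<kappa>" using lam m by (simp add: \<kappa>_def)
  define s where "s = - ln (1 - \<delta>) / Kl"
  define t where "t = N * ((1 - \<delta>) * \<sigma>)"
  have s0: "0 \<le> s"
    unfolding s_def using \<delta> Kl0 by (intro divide_nonneg_pos) auto
  have t0: "0 \<le> t" using \<delta> \<sigma>1 by (simp add: t_def)
  have mean: "\<sigma> * dotp n v v \<le> dotp n v (mat_vec n (\<lambda>i j. \<integral>x. X x i j \<partial>p) v)" for v
  proof -
    have "\<sigma> * dotp n v v = (\<Sum>i<n. v i * (\<sigma> * v i))"
      by (simp add: dotp_def sum_distrib_left mult_ac)
    also have "\<dots> \<le> (\<Sum>i<n. v i * ((1 + lam * m i) * v i))"
    proof (rule sum_mono)
      fix i assume "i \<in> {..<n}"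
      then have "\<sigma> * (v i * v i) \<le> (1 + lam * m i) * (v i * v i)"
        using m lam by (intro mult_right_mono) (auto simp: \<sigma>_def intro: mult_left_mono)
      then show "v i * (\<sigma> * v i) \<le> v i * ((1 + lam * m i) * v i)" by (simp add: mult_ac)
    qed
    also have "\<dots> = dotp n v (mat_vec n (\<lambda>i j. \<integral>x. X x i j \<partial>p) v)"
      by (simp add: dotp_def mat_vec_def meanX if_distrib[of "\<lambda>x. x * _"] sum.delta cong: if_cong)
    finally show ?thesis .
  qed
  obtain h where h: "integrable (PiM {..<N} (\<lambda>_. p)) h"
    "\<And>\<omega>. \<omega> \<in> space (PiM {..<N} (\<lambda>_. p)) \<Longrightarrow> 0 \<le> h \<omega>"
    "\<And>\<omega> v. \<omega> \<in> space (PiM {..<N} (\<lambda>_. p)) \<Longrightarrow> dotp n v v = 1 \<Longrightarrow>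
      (\<Sum>j<N. dotp n v (mat_vec n (X (\<omega> j)) v)) \<le> t \<Longrightarrow> 1 \<le> h \<omega>"
    "(\<integral>\<omega>. h \<omega> \<partial>PiM {..<N} (\<lambda>_. p)) \<le> 2 * n * exp (s * t) * (1 - (1 - exp (- (s * Kl))) / Kl * \<sigma>) ^ N"
    by (rule matrix_Chernoff_lower_tail[OF p bounded_measurable_measurable[OF Xb] symX psdX leX Kl0 mean _ \<sigma>Kl s0 t0])
      (use \<sigma>1 in auto)
  have hN: "(\<integral>\<omega>. h \<omega> \<partial>PiM {..<N} (\<lambda>_. p)) \<le> N powr (- r) / 2"
    using h(4) tail_bound[OF num] unfolding s_def t_def \<sigma>_def by (rule order_trans)
  \<comment> \<open>Orthogonality of the residual to the basis serves twice: for the Pythagorean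
    identity \<open>risk\<close>, and to centre the summands of \<open>b\<close>.\<close>
  have gL: "(\<integral>x. g x * L x i \<partial>p) = 0" if i: "i < n" for i
  proof -
    have "(\<integral>x. g x * L x i \<partial>p) = (\<integral>x. F x * L x i - (\<Sum>j<n. w j * (L x j * L x i)) \<partial>p)"
      by (intro Bochner_Integration.integral_cong)
        (simp_all add: g_def dotp_def left_diff_distrib sum_distrib_right mult.assoc)
    also have "\<dots> = (\<integral>x. F x * L x i \<partial>p) - (\<integral>x. (\<Sum>j<n. w j * (L x j * L x i)) \<partial>p)"
      using i by (intro Bochner_Integration.integral_diff intg bounded_measurable_intros Fb L) auto
    also have "(\<integral>x. (\<Sum>j<n. w j * (L x j * L x i)) \<partial>p) = (\<Sum>j<n. \<integral>x. w j * (L x j * L x i) \<partial>p)"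
      using i by (intro Bochner_Integration.integral_sum intg bounded_measurable_intros L) auto
    also have "\<dots> = w i"
      using i by (simp add: orth if_distrib[of "\<lambda>x. _ * x"] sum.delta cong: if_cong)
    finally show ?thesis by (simp add: w_def)
  qed
  have risk: "(\<integral>x. (F x - dotp n c (L x))\<^sup>2 \<partial>p) = e + dotp n (\<lambda>i. c i - w i) (\<lambda>i. c i - w i)" for c
  proof -
    define z where "z = (\<lambda>i. c i - w i)"
    have zg: "(\<integral>x. g x * dotp n z (L x) \<partial>p) = 0"
    proof -
      have "(\<integral>x. g x * dotp n z (L x) \<partial>p) = (\<integral>x. (\<Sum>i<n. z i * (g x * L x i)) \<partial>p)"
        by (simp add: dotp_def sum_distrib_left mult_ac)
      also have "\<dots> = (\<Sum>i<n. \<integral>x. z i * (g x * L x i) \<partial>p)"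
        by (intro Bochner_Integration.integral_sum intg bounded_measurable_intros gb L) auto
      finally show ?thesis by (simp add: gL)
    qed
    have zz: "(\<integral>x. (dotp n z (L x))\<^sup>2 \<partial>p) = dotp n z z"
    proof -
      have "(\<integral>x. (dotp n z (L x))\<^sup>2 \<partial>p) = (\<integral>x. (\<Sum>i<n. \<Sum>j<n. z i * z j * (L x i * L x j)) \<partial>p)"
        by (simp add: dotp_def power2_eq_square sum_product mult_ac)
      also have "\<dots> = (\<Sum>i<n. \<integral>x. (\<Sum>j<n. z i * z j * (L x i * L x j)) \<partial>p)"
        by (intro Bochner_Integration.integral_sum intg bounded_measurable_intros L) auto
      also have "\<dots> = (\<Sum>i<n. \<Sum>j<n. \<integral>x. z i * z j * (L x i * L x j) \<partial>p)"
        by (intro sum.cong refl Bochner_Integration.integral_sum intg bounded_measurable_intros L) auto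
      also have "\<dots> = dotp n z z"
        by (simp add: orth dotp_def if_distrib[of "\<lambda>x. _ * x"] sum.delta cong: if_cong)
      finally show ?thesis .
    qed
    have "(\<integral>x. (F x - dotp n c (L x))\<^sup>2 \<partial>p)
        = (\<integral>x. (g x)\<^sup>2 - 2 * (g x * dotp n z (L x)) + (dotp n z (L x))\<^sup>2 \<partial>p)"
      by (intro Bochner_Integration.integral_cong)
        (simp_all add: g_def z_def dotp_linear power2_eq_square algebra_simps)
    also have "\<dots> = (\<integral>x. (g x)\<^sup>2 \<partial>p) - 2 * (\<integral>x. g x * dotp n z (L x) \<partial>p) + (\<integral>x. (dotp n z (L x))\<^sup>2 \<partial>p)"
      using intg[OF bounded_measurable_power[OF gb, of 2]] intg[OF bounded_measurable_mult[OF gb ipL[of z]]]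
        intg[OF bounded_measurable_power[OF ipL[of z], of 2]] by simp
    finally show ?thesis unfolding zg zz by (simp add: e_def g_def z_def)
  qed
  define b where "b \<omega> = (\<lambda>i. (\<Sum>l<N. g (\<omega> l) * L (\<omega> l) i) / N)" for \<omega>
  define W where "W \<omega> = (\<Sum>l<N. dotp n w (mat_vec n (B (\<omega> l)) w)) / N" for \<omega>
  \<comment> \<open>One majorant for both events: on the good one the first three terms bound the
    risk, on the bad one \<open>h\<close> \<ge> 1 makes the last term at least the trivial bound 4
    M^2.\<close>
  define R where "R \<omega> = e + 4 * dotp n (b \<omega>) (b \<omega>) / \<kappa>\<^sup>2 + 4 * lam * W \<omega> + 4 * M\<^sup>2 * h \<omega>" for \<omega>
  have e0: "0 \<le> e" by (simp add: e_def)
  have intW: "integrable (PiM {..<N} (\<lambda>_. p)) W"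
    unfolding W_def[abs_def]
    by (intro integrable_divide_zero PN.integrable_bounded_measurable bounded_measurable_intros
        bounded_measurable_compose[OF qBb]) auto
  have intb: "integrable (PiM {..<N} (\<lambda>_. p)) (\<lambda>\<omega>. (b \<omega> i)\<^sup>2)" if "i < n" for i
    unfolding b_def divide_inverse using that
    by (intro PN.integrable_bounded_measurable bounded_measurable_intros
        bounded_measurable_compose[OF gb] bounded_measurable_compose[OF L]) auto
  then have intbb: "integrable (PiM {..<N} (\<lambda>_. p)) (\<lambda>\<omega>. dotp n (b \<omega>) (b \<omega>))"
    unfolding dotp_def power2_eq_square[symmetric] by (intro Bochner_Integration.integrable_sum) auto
  have intR: "integrable (PiM {..<N} (\<lambda>_. p)) R"
    unfolding R_def[abs_def] using intW intbb h(1) by simp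
  have W0: "0 \<le> W \<omega>" if "\<omega> \<in> space (PiM {..<N} (\<lambda>_. p))" for \<omega>
    unfolding W_def using that
    by (intro divide_nonneg_nonneg sum_nonneg psdB) (auto simp: space_PiM)
  have "(\<integral>\<omega>. (\<integral>x. (F x - max (- M) (min (dotp n (S \<omega>) (L x)) M))\<^sup>2 \<partial>p) \<partial>PiM {..<N} (\<lambda>_. p))
    \<le> (\<integral>\<omega>. R \<omega> \<partial>PiM {..<N} (\<lambda>_. p))"
  \<comment> \<open>This rule asks for 0 \<le> \<open>R\<close> because an integrand that is not
    integrable has integral 0 by convention.\<close>
  proof (rule integral_mono'[OF intR])
    fix \<omega> assume \<omega>: "\<omega> \<in> space (PiM {..<N} (\<lambda>_. p))"
    then have \<omega>p: "\<omega> l \<in> space p" if "l < N" for l using that by (auto simp: space_PiM)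
    have nn: "0 \<le> 4 * dotp n (b \<omega>) (b \<omega>) / \<kappa>\<^sup>2" "0 \<le> 4 * lam * W \<omega>" "0 \<le> 4 * M\<^sup>2 * h \<omega>"
      using W0[OF \<omega>] h(2)[OF \<omega>] lam by (simp_all add: dotp_self_nonneg)
    then show "0 \<le> R \<omega>" using e0 by (simp add: R_def)
    show "(\<integral>x. (F x - max (- M) (min (dotp n (S \<omega>) (L x)) M))\<^sup>2 \<partial>p) \<le> R \<omega>"
    proof (cases "\<exists>v. dotp n v v = 1 \<and> (\<Sum>l<N. dotp n v (mat_vec n (X (\<omega> l)) v)) \<le> t")
      case True
      then have "1 \<le> h \<omega>" using h(3)[OF \<omega>] by blast
      then have "4 * M\<^sup>2 * 1 \<le> 4 * M\<^sup>2 * h \<omega>" by (intro mult_left_mono) auto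
      have "(\<integral>x. (F x - max (- M) (min (dotp n (S \<omega>) (L x)) M))\<^sup>2 \<partial>p) \<le> (\<integral>x. 4 * M\<^sup>2 \<partial>p)"
        by (rule integral_mono') (auto intro!: clip_sq_le F)
      also have "\<dots> \<le> R \<omega>"
        using \<open>4 * M\<^sup>2 * 1 \<le> 4 * M\<^sup>2 * h \<omega>\<close> nn e0 by (simp add: R_def p.prob_space)
      finally show ?thesis .
    next
      case False
      have stable: "\<kappa> * N * dotp n v v
        \<le> (\<Sum>l<N. (dotp n v (L (\<omega> l)))\<^sup>2 + lam * dotp n v (mat_vec n (B (\<omega> l)) v))" for v
      proof (cases "dotp n v v = 0")
        case True
        then show ?thesis using \<omega>p psdB lam by (auto intro!: sum_nonneg)
      next
        case nz: False
        \<comment> \<open>Absence of the bad event concerns unit vectors; rescaling carries it to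
          every v with v . v > 0.\<close>
        define a where "a = 1 / sqrt (dotp n v v)"
        have vv: "0 < dotp n v v" using nz dotp_self_nonneg[of n v] by simp
        have a: "a\<^sup>2 * dotp n v v = 1" using vv by (simp add: a_def power_divide)
        define u where "u = (\<lambda>i. a * v i)"
        have q: "dotp n u (mat_vec n A u) = a\<^sup>2 * dotp n v (mat_vec n A v)" for A
          by (simp add: u_def mat_vec_scale dotp_linear power2_eq_square)
        have "dotp n u u = 1" using a by (simp add: u_def dotp_linear power2_eq_square mult.assoc)
        then have "t \<le> (\<Sum>l<N. dotp n u (mat_vec n (X (\<omega> l)) u))" using False by (metis linear)
        also have "\<dots> = a\<^sup>2 * (\<Sum>l<N. dotp n v (mat_vec n (X (\<omega> l)) v))"
          by (simp add: q sum_distrib_left)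
        finally have "dotp n v v * t \<le> dotp n v v * (a\<^sup>2 * (\<Sum>l<N. dotp n v (mat_vec n (X (\<omega> l)) v)))"
          using vv by (intro mult_left_mono) auto
        also have "\<dots> = (a\<^sup>2 * dotp n v v) * (\<Sum>l<N. dotp n v (mat_vec n (X (\<omega> l)) v))"
          by (simp only: mult_ac)
        finally have "dotp n v v * t \<le> (\<Sum>l<N. dotp n v (mat_vec n (X (\<omega> l)) v))" by (simp add: a)
        moreover have "\<kappa> * N * dotp n v v \<le> dotp n v v * t"
          using mult_right_mono[OF gap, of "N * dotp n v v"] vv by (simp add: t_def mult_ac)
        ultimately show ?thesis by (simp add: quadX)
      qed
      have "dotp n (\<lambda>i. S \<omega> i - w i) (\<lambda>i. S \<omega> i - w i)
        \<le> 4 * dotp n (\<lambda>i. (\<Sum>l<N. (F (\<omega> l) - dotp n w (L (\<omega> l))) * L (\<omega> l) i) / N)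
            (\<lambda>i. (\<Sum>l<N. (F (\<omega> l) - dotp n w (L (\<omega> l))) * L (\<omega> l) i) / N) / \<kappa>\<^sup>2
          + 4 * lam * ((\<Sum>l<N. dotp n w (mat_vec n (B (\<omega> l)) w)) / N)"
        by (rule regression_error_le[where y="\<lambda>l. F (\<omega> l)"])
          (use symB psdB \<omega>p lam N \<kappa> stable S_min[OF \<omega>] in auto)
      then have z: "dotp n (\<lambda>i. S \<omega> i - w i) (\<lambda>i. S \<omega> i - w i)
        \<le> 4 * dotp n (b \<omega>) (b \<omega>) / \<kappa>\<^sup>2 + 4 * lam * W \<omega>"
        by (simp only: b_def W_def g_def)
      have "(\<integral>x. (F x - max (- M) (min (dotp n (S \<omega>) (L x)) M))\<^sup>2 \<partial>p) \<le> (\<integral>x. (F x - dotp n (S \<omega>) (L x))\<^sup>2 \<partial>p)"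
      proof (rule integral_mono')
        show "integrable p (\<lambda>x. (F x - dotp n (S \<omega>) (L x))\<^sup>2)"
          by (intro intg bounded_measurable_intros Fb ipL)
      qed (auto intro!: clip_sq_le F)
      also have "\<dots> \<le> R \<omega>" unfolding risk R_def using z nn by linarith
      finally show ?thesis .
    qed
  qed
  also have "(\<integral>\<omega>. R \<omega> \<partial>PiM {..<N} (\<lambda>_. p)) = e + 4 * (\<integral>\<omega>. dotp n (b \<omega>) (b \<omega>) \<partial>PiM {..<N} (\<lambda>_. p)) / \<kappa>\<^sup>2
      + 4 * lam * (\<integral>\<omega>. W \<omega> \<partial>PiM {..<N} (\<lambda>_. p)) + 4 * M\<^sup>2 * (\<integral>\<omega>. h \<omega> \<partial>PiM {..<N} (\<lambda>_. p))"
    unfolding R_def using intW intbb h(1) by (simp add: PN.prob_space)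
  also have "(\<integral>\<omega>. W \<omega> \<partial>PiM {..<N} (\<lambda>_. p)) = (\<integral>x. dotp n w (mat_vec n (B x) w) \<partial>p)"
  proof -
    have "(\<integral>\<omega>. W \<omega> \<partial>PiM {..<N} (\<lambda>_. p))
        = (\<Sum>l<N. \<integral>\<omega>. dotp n w (mat_vec n (B (\<omega> l)) w) \<partial>PiM {..<N} (\<lambda>_. p)) / N"
      unfolding W_def integral_divide_zero
      by (intro arg_cong2[where f="(/)"] refl Bochner_Integration.integral_sum
          PN.integrable_bounded_measurable bounded_measurable_compose[OF qBb]) auto
    also have "\<dots> = (\<integral>x. dotp n w (mat_vec n (B x) w) \<partial>p)"
      using N by (simp add: integral_PiM_component[OF p _ bounded_measurable_measurable[OF qBb]])
    finally show ?thesis .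
  qed
  \<comment> \<open>Each b_i has second moment equal to that of g L_i divided by N; summing over i
    under the integral and bounding the sum of the L_i^2 by \<open>Kl\<close> leaves e Kl /
    N.\<close>
  also have "4 * (\<integral>\<omega>. dotp n (b \<omega>) (b \<omega>) \<partial>PiM {..<N} (\<lambda>_. p)) / \<kappa>\<^sup>2
      \<le> 4 * (e * (cdelta (1 / 2) / (ln N * (1 + r)))) / \<kappa>\<^sup>2"
  proof (intro divide_right_mono mult_left_mono)
    have "(\<integral>\<omega>. dotp n (b \<omega>) (b \<omega>) \<partial>PiM {..<N} (\<lambda>_. p)) = (\<Sum>i<n. \<integral>\<omega>. (b \<omega> i)\<^sup>2 \<partial>PiM {..<N} (\<lambda>_. p))"
      unfolding dotp_def power2_eq_square[symmetric]
      by (intro Bochner_Integration.integral_sum intb) auto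
    also have "\<dots> = (\<Sum>i<n. (\<integral>x. (g x * L x i)\<^sup>2 \<partial>p) / N)"
    proof (intro sum.cong refl)
      fix i assume i: "i \<in> {..<n}"
      have "(\<integral>\<omega>. (\<Sum>l<N. g (\<omega> l) * L (\<omega> l) i)\<^sup>2 \<partial>PiM {..<N} (\<lambda>_. p)) = N * (\<integral>x. (g x * L x i)\<^sup>2 \<partial>p)"
        using i by (intro integral_PiM_sum_sq[where f="\<lambda>x. g x * L x i"] p gL bounded_measurable_mult gb L) auto
      then show "(\<integral>\<omega>. (b \<omega> i)\<^sup>2 \<partial>PiM {..<N} (\<lambda>_. p)) = (\<integral>x. (g x * L x i)\<^sup>2 \<partial>p) / N"
        using N by (simp add: b_def power_divide) (simp add: power2_eq_square)
    qed
    also have "\<dots> = (\<integral>x. (\<Sum>i<n. (g x * L x i)\<^sup>2) \<partial>p) / N"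
      unfolding sum_divide_distrib[symmetric]
      by (intro arg_cong2[where f="(/)"] refl Bochner_Integration.integral_sum[symmetric]
          intg bounded_measurable_intros gb L) auto
    also have "\<dots> \<le> (\<integral>x. (g x)\<^sup>2 * Kl \<partial>p) / N"
    proof (intro divide_right_mono integral_mono intg bounded_measurable_intros gb L)
      fix x assume x: "x \<in> space p"
      define ei where "ei l = (\<lambda>a. if a = l then 1 else 0 :: real)" for l :: nat
      have "0 \<le> B x i i" if "i < n" for i
        using psdB[OF x, of "ei i"] that
        by (simp add: dotp_def mat_vec_def ei_def if_distrib[of "\<lambda>x. x * _"] if_distrib[of "\<lambda>x. _ * x"] sum.delta
            cong: if_cong)
      then have "(\<Sum>i<n. (L x i)\<^sup>2) \<le> (\<Sum>i<n. (L x i)\<^sup>2 + lam * B x i i)"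
        using lam by (intro sum_mono) auto
      then have "(g x)\<^sup>2 * (\<Sum>i<n. (L x i)\<^sup>2) \<le> (g x)\<^sup>2 * Kl"
        using Kl[OF x] by (intro mult_left_mono) auto
      then show "(\<Sum>i<n. (g x * L x i)\<^sup>2) \<le> (g x)\<^sup>2 * Kl"
        by (simp add: power_mult_distrib sum_distrib_left)
    qed auto
    also have "\<dots> = e * (Kl / N)" by (simp add: e_def g_def)
    also have "\<dots> \<le> e * (cdelta (1 / 2) / (ln N * (1 + r)))"
      using Kl_over_N[OF num] e0 by (intro mult_left_mono)
    finally show "(\<integral>\<omega>. dotp n (b \<omega>) (b \<omega>) \<partial>PiM {..<N} (\<lambda>_. p)) \<le> e * (cdelta (1 / 2) / (ln N * (1 + r)))" .
  qed auto
  also have "4 * (e * (cdelta (1 / 2) / (ln N * (1 + r)))) / \<kappa>\<^sup>2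
      = e * (4 * (cdelta (1 / 2) / (ln N * (1 + r) * \<kappa>\<^sup>2)))"
    by simp
  \<comment> \<open>For x \<le> 1/2 one has 4 x \<le> 1 + 2 x; with the separate summand
    \<open>e\<close> this becomes 2 e (1 + x).\<close>
  also have "\<dots> \<le> e * (1 + 2 * (cdelta (1 / 2) / (ln N * (1 + r) * \<kappa>\<^sup>2)))"
    using variance_factor_le_half[OF num] e0 by (intro mult_left_mono) (auto simp: \<kappa>_def)
  also have "4 * M\<^sup>2 * (\<integral>\<omega>. h \<omega> \<partial>PiM {..<N} (\<lambda>_. p)) \<le> 4 * M\<^sup>2 * (N powr (- r) / 2)"
    using hN by (intro mult_left_mono) auto
  finally show ?thesis by (simp add: \<kappa>_def algebra_simps)
qed

section \<open>Cylinder functions\<close>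

lemma C1b_gradD:
  assumes "C1b_grad f g"
  shows "continuous_on UNIV f" "continuous_on UNIV g" "\<exists>C. \<forall>x. \<bar>f x\<bar> \<le> C" "\<exists>C. \<forall>x. norm (g x) \<le> C"
proof -
  have "isCont f x" for x
    using assms has_derivative_continuous unfolding C1b_grad_def by blast
  then show "continuous_on UNIV f" by (simp add: continuous_on_eq_continuous_at)
  show "continuous_on UNIV g" "\<exists>C. \<forall>x. \<bar>f x\<bar> \<le> C" "\<exists>C. \<forall>x. norm (g x) \<le> C"
    using assms by (auto simp: C1b_grad_def bounded_iff)
qed

lemma bounded_measurable_cong_sets:
  assumes "sets M = sets N"
  shows "bounded_measurable M f \<longleftrightarrow> bounded_measurable N f"
  unfolding bounded_measurable_def
  by (simp add: measurable_cong_sets[OF assms refl] sets_eq_imp_space_eq[OF assms])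

lemma bounded_measurable_PK_member:
  assumes "\<mu> \<in> space (PK K)" "bounded_measurable borel f"
  shows "bounded_measurable \<mu> f"
proof -
  have "sets \<mu> = sets (restrict_space borel K)"
    using assms(1) by (simp add: PK_def space_prob_algebra)
  then show ?thesis
    using assms(2) unfolding bounded_measurable_cong_sets[OF \<open>sets \<mu> = _\<close>]
    by (auto simp: bounded_measurable_def measurable_restrict_space1 space_restrict_space)
qed

lemma bounded_measurable_integral_PK:
  fixes f :: "'a::euclidean_space \<Rightarrow> real"
  assumes f: "bounded_measurable borel f"
  shows "bounded_measurable (PK K) (\<lambda>\<mu>. \<integral>x. f x \<partial>\<mu>)"
proof -
  obtain C where C: "\<And>x. \<bar>f x\<bar> \<le> C" using f by (auto simp: bounded_measurable_def)
  show ?thesis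
  proof (rule bounded_measurableI[where B=C])
    have "f \<in> borel_measurable (restrict_space borel K)"
      by (rule measurable_restrict_space1) (rule bounded_measurable_measurable[OF f])
    then show "(\<lambda>\<mu>. \<integral>x. f x \<partial>\<mu>) \<in> borel_measurable (PK K)"
      unfolding PK_def prob_algebra_def
      by (rule measurable_restrict_space1[OF integral_measurable_subprob_algebra])
    fix \<mu> assume \<mu>: "\<mu> \<in> space (PK K)"
    then interpret prob_space \<mu> by (simp add: PK_def space_prob_algebra)
    have "integrable \<mu> f"
      by (intro integrable_bounded_measurable bounded_measurable_PK_member[OF \<mu> f])
    then have "\<bar>\<integral>x. f x \<partial>\<mu>\<bar> \<le> (\<integral>x. C \<partial>\<mu>)"
      using C by (intro order_trans[OF integral_abs_bound] integral_mono) auto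
    then show "\<bar>\<integral>x. f x \<partial>\<mu>\<bar> \<le> C" by (simp add: prob_space)
  qed
qed

lemma bounded_measurable_continuous_vec:
  fixes g :: "'b \<Rightarrow> real ^ 'm::finite" and h :: "real ^ 'm \<Rightarrow> real"
  assumes "\<And>k. (\<lambda>x. g x $ k) \<in> borel_measurable M" "continuous_on UNIV h" "\<And>y. \<bar>h y\<bar> \<le> C"
  shows "bounded_measurable M (\<lambda>x. h (g x))"
proof (rule bounded_measurableI[where B=C])
  have "g \<in> borel_measurable M"
    using assms(1) by (subst borel_measurable_euclidean_space) (auto simp: Basis_vec_def inner_axis)
  then show "(\<lambda>x. h (g x)) \<in> borel_measurable M"
    using assms(2) by (rule borel_measurable_continuous_on[rotated])
qed (rule assms)

context
  fixes K :: "'a::euclidean_space set" and n :: nat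
    and \<psi> :: "nat \<Rightarrow> real^'m::finite \<Rightarrow> real" and g\<psi> :: "nat \<Rightarrow> real^'m \<Rightarrow> real^'m"
    and \<phi> :: "nat \<Rightarrow> 'm \<Rightarrow> 'a \<Rightarrow> real" and g\<phi> :: "nat \<Rightarrow> 'm \<Rightarrow> 'a \<Rightarrow> 'a"
  assumes \<psi>: "\<And>i. i < n \<Longrightarrow> C1b_grad (\<psi> i) (g\<psi> i)"
    and \<phi>: "\<And>i k. i < n \<Longrightarrow> C1b_grad (\<phi> i k) (g\<phi> i k)"
begin

abbreviation (input) "Dc i \<equiv> Dcyl (g\<psi> i) (\<phi> i) (g\<phi> i)"

lemma bounded_measurable_\<phi>: "i < n \<Longrightarrow> bounded_measurable borel (\<phi> i k)"
  using C1b_gradD[OF \<phi>, of i k]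
  by (auto simp: bounded_measurable_def intro: borel_measurable_continuous_onI)

lemma bounded_measurable_grad_inner:
  assumes "i < n" "j < n"
  shows "bounded_measurable borel (\<lambda>x. g\<phi> i k x \<bullet> g\<phi> j l x)"
proof -
  obtain A where A: "\<And>x. norm (g\<phi> i k x) \<le> A" using C1b_gradD(4)[OF \<phi>] assms by blast
  obtain B where B: "\<And>x. norm (g\<phi> j l x) \<le> B" using C1b_gradD(4)[OF \<phi>] assms by blast
  show ?thesis
  proof (rule bounded_measurableI[where B="A * B"])
    show "(\<lambda>x. g\<phi> i k x \<bullet> g\<phi> j l x) \<in> borel_measurable borel"
      using C1b_gradD(2)[OF \<phi>] assms
      by (intro borel_measurable_continuous_onI continuous_intros) auto
    show "\<bar>g\<phi> i k x \<bullet> g\<phi> j l x\<bar> \<le> A * B" for x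
      using Cauchy_Schwarz_ineq2 mult_mono[OF A B] by (meson A norm_ge_zero order_trans)
  qed
qed

lemma Lphi_measurable:
  assumes "i < n" shows "(\<lambda>\<mu>. Lphi (\<phi> i) \<mu> $ k) \<in> borel_measurable (PK K)"
  using bounded_measurable_measurable[OF bounded_measurable_integral_PK[OF bounded_measurable_\<phi>[OF assms]]]
  by (simp add: Lphi_def)

lemma bounded_measurable_cyl:
  assumes "i < n" shows "bounded_measurable (PK K) (cyl (\<psi> i) (\<phi> i))"
proof -
  obtain C where C: "\<And>y. \<bar>\<psi> i y\<bar> \<le> C" using C1b_gradD(3)[OF \<psi>] assms by blast
  show ?thesis
    unfolding cyl_def[abs_def]
    by (intro bounded_measurable_continuous_vec[OF Lphi_measurable _ C] C1b_gradD(1)[OF \<psi>] assms)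
qed

lemma bounded_measurable_coeff:
  assumes "i < n" shows "bounded_measurable (PK K) (\<lambda>\<mu>. g\<psi> i (Lphi (\<phi> i) \<mu>) $ k)"
proof -
  obtain C where C: "\<And>y. norm (g\<psi> i y) \<le> C" using C1b_gradD(4)[OF \<psi>] assms by blast
  have "\<bar>g\<psi> i y $ k\<bar> \<le> C" for y
    using component_le_norm_cart[of "g\<psi> i y" k] C[of y] by simp
  then show ?thesis
    by (intro bounded_measurable_continuous_vec[OF Lphi_measurable, where h="\<lambda>y. g\<psi> i y $ k"]
        continuous_intros C1b_gradD(2)[OF \<psi>] assms)
qed

lemma Dcyl_inner:
  "Dc i \<mu> x \<bullet> Dc j \<mu> x = (\<Sum>k\<in>UNIV. \<Sum>l\<in>UNIV. g\<psi> i (Lphi (\<phi> i) \<mu>) $ k * g\<psi> j (Lphi (\<phi> j) \<mu>) $ l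
    * (g\<phi> i k x \<bullet> g\<phi> j l x))"
  unfolding Dcyl_def inner_sum_left unfolding inner_sum_right by (simp add: mult_ac)

lemma integrable_Dcyl_inner:
  assumes \<mu>: "\<mu> \<in> space (PK K)" and "i < n" "j < n"
  shows "integrable \<mu> (\<lambda>x. Dc i \<mu> x \<bullet> Dc j \<mu> x)"
proof -
  interpret prob_space \<mu> using \<mu> by (simp add: PK_def space_prob_algebra)
  show ?thesis unfolding Dcyl_inner
    by (intro integrable_bounded_measurable bounded_measurable_intros
        bounded_measurable_PK_member[OF \<mu> bounded_measurable_grad_inner] assms)
qed

text \<open>Here \<mu> enters the integrand as well as the integrator. Expanding the inner product
  into a finite sum separates the coefficients from integrals of fixed functions, which are
  measurable in \<mu>.\<close>

lemma bounded_measurable_integral_Dcyl_inner: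
  assumes "i < n" "j < n"
  shows "bounded_measurable (PK K) (\<lambda>\<mu>. \<integral>x. Dc i \<mu> x \<bullet> Dc j \<mu> x \<partial>\<mu>)"
proof -
  have "bounded_measurable (PK K) (\<lambda>\<mu>. \<Sum>k\<in>UNIV. \<Sum>l\<in>UNIV. g\<psi> i (Lphi (\<phi> i) \<mu>) $ k
      * g\<psi> j (Lphi (\<phi> j) \<mu>) $ l * (\<integral>x. g\<phi> i k x \<bullet> g\<phi> j l x \<partial>\<mu>))"
    by (intro bounded_measurable_intros bounded_measurable_coeff bounded_measurable_integral_PK
        bounded_measurable_grad_inner assms)
  moreover have "(\<integral>x. Dc i \<mu> x \<bullet> Dc j \<mu> x \<partial>\<mu>) = (\<Sum>k\<in>UNIV. \<Sum>l\<in>UNIV. g\<psi> i (Lphi (\<phi> i) \<mu>) $ k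
      * g\<psi> j (Lphi (\<phi> j) \<mu>) $ l * (\<integral>x. g\<phi> i k x \<bullet> g\<phi> j l x \<partial>\<mu>))"
    if \<mu>: "\<mu> \<in> space (PK K)" for \<mu>
  proof -
    interpret prob_space \<mu> using \<mu> by (simp add: PK_def space_prob_algebra)
    have "integrable \<mu> (\<lambda>x. g\<phi> i k x \<bullet> g\<phi> j l x)" for k l
      by (intro integrable_bounded_measurable bounded_measurable_PK_member[OF \<mu>]
          bounded_measurable_grad_inner assms)
    then show ?thesis
      unfolding Dcyl_inner by (simp add: Bochner_Integration.integral_sum)
  qed
  ultimately show ?thesis
    unfolding bounded_measurable_def by (simp cong: measurable_cong)
qed

text \<open>The bridge from the functional \<open>J\<close> to quadratic forms; semidefiniteness of
  the energy matrix is read off from the left side.\<close>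

lemma integral_norm_sum_Dcyl:
  assumes \<mu>: "\<mu> \<in> space (PK K)"
  shows "(\<integral>x. (norm (\<Sum>i<n. v i *\<^sub>R Dc i \<mu> x))\<^sup>2 \<partial>\<mu>)
    = dotp n v (mat_vec n (\<lambda>i j. \<integral>x. Dc i \<mu> x \<bullet> Dc j \<mu> x \<partial>\<mu>) v)"
proof -
  note int = integrable_Dcyl_inner[OF \<mu>]
  have "(\<integral>x. (norm (\<Sum>i<n. v i *\<^sub>R Dc i \<mu> x))\<^sup>2 \<partial>\<mu>)
      = (\<integral>x. (\<Sum>i<n. \<Sum>j<n. v i * v j * (Dc i \<mu> x \<bullet> Dc j \<mu> x)) \<partial>\<mu>)"
    unfolding power2_norm_eq_inner inner_sum_left unfolding inner_sum_right by (simp add: mult_ac)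
  also have "\<dots> = (\<Sum>i<n. \<integral>x. (\<Sum>j<n. v i * v j * (Dc i \<mu> x \<bullet> Dc j \<mu> x)) \<partial>\<mu>)"
    by (intro Bochner_Integration.integral_sum Bochner_Integration.integrable_sum
        integrable_mult_right int) auto
  also have "\<dots> = (\<Sum>i<n. \<Sum>j<n. \<integral>x. v i * v j * (Dc i \<mu> x \<bullet> Dc j \<mu> x) \<partial>\<mu>)"
    by (intro sum.cong refl Bochner_Integration.integral_sum integrable_mult_right int) auto
  finally show ?thesis by (simp add: dotp_def mat_vec_def sum_distrib_left mult_ac)
qed

end

section \<open>The risk bound for cylinder functions on \<open>PK K\<close>\<close>

theorem theorem4p13:
  fixes K :: "'a::euclidean_space set"
    and p :: "'a measure measure"
    and lam r M :: real and n N :: nat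
    and \<psi> :: "nat \<Rightarrow> real^'m::finite \<Rightarrow> real" and g\<psi> :: "nat \<Rightarrow> real^'m \<Rightarrow> real^'m"
    and \<phi> :: "nat \<Rightarrow> 'm \<Rightarrow> 'a \<Rightarrow> real" and g\<phi> :: "nat \<Rightarrow> 'm \<Rightarrow> 'a \<Rightarrow> 'a"
    and F :: "'a measure \<Rightarrow> real"
    and S :: "(nat \<Rightarrow> 'a measure) \<Rightarrow> nat \<Rightarrow> real"
    and ell :: "nat \<Rightarrow> 'a measure \<Rightarrow> real" and Dell :: "nat \<Rightarrow> 'a measure \<Rightarrow> 'a \<Rightarrow> 'a"
    and PnF :: "'a measure \<Rightarrow> real"
  defines "ell \<equiv> (\<lambda>i. cyl (\<psi> i) (\<phi> i))"
    and "Dell \<equiv> (\<lambda>i. Dcyl (g\<psi> i) (\<phi> i) (g\<phi> i))"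
    and "Kl \<equiv> (SUP \<mu>\<in>space (PK K). \<Sum>i<n. (ell i \<mu>)\<^sup>2 + lam * (\<integral>x. (norm (Dell i \<mu> x))\<^sup>2 \<partial>\<mu>))"
    and "mumin \<equiv> Min ((\<lambda>i. pCE p (Dell i) (Dell i)) ` {..<n})"
    and "mumax \<equiv> Max ((\<lambda>i. pCE p (Dell i) (Dell i)) ` {..<n})"
    and "PnF \<equiv> (\<lambda>\<mu>. \<Sum>i<n. (\<integral>\<nu>. F \<nu> * ell i \<nu> \<partial>p) * ell i \<mu>)"
    and "DPnF \<equiv> (\<lambda>\<mu> x. \<Sum>i<n. (\<integral>\<nu>. F \<nu> * ell i \<nu> \<partial>p) *\<^sub>R Dell i \<mu> x)"
    and "eFn \<equiv> (\<integral>\<mu>. (PnF \<mu> - F \<mu>)\<^sup>2 \<partial>p)"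
    and "J \<equiv> (\<lambda>\<omega> c. (\<Sum>j<N. (F (\<omega> j) - (\<Sum>i<n. c i * ell i (\<omega> j)))\<^sup>2) / real N
               + lam * ((\<Sum>j<N. \<integral>x. (norm (\<Sum>i<n. c i *\<^sub>R Dell i (\<omega> j) x))\<^sup>2 \<partial>(\<omega> j)) / real N))"
    and "Fstar \<equiv> (\<lambda>\<omega> \<mu>. max (- M) (min (\<Sum>i<n. S \<omega> i * ell i \<mu>) M))"
  assumes K: "compact K"
    and p: "prob_space p" "sets p = sets (PK K)"
    and lam: "lam \<ge> 0"
    and n: "n \<ge> 1"
    and cyl: "\<And>i. i < n \<Longrightarrow> C1b_grad (\<psi> i) (g\<psi> i)"
             "\<And>i k. i < n \<Longrightarrow> C1b_grad (\<phi> i k) (g\<phi> i k)"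
    and orthonormal: "\<And>i j. i < n \<Longrightarrow> j < n \<Longrightarrow>
                         (\<integral>\<mu>. ell i \<mu> * ell j \<mu> \<partial>p) = (if i = j then 1 else 0)"
    and pCE_orth: "\<And>i j. i < n \<Longrightarrow> j < n \<Longrightarrow> i \<noteq> j \<Longrightarrow> pCE p (Dell i) (Dell j) = 0"
    and M: "M > 0"
    and F_meas: "F \<in> borel_measurable (PK K)"
    and F_bound: "\<And>\<mu>. \<mu> \<in> space (PK K) \<Longrightarrow> \<bar>F \<mu>\<bar> \<le> M"
    and S_meas: "\<And>i. i < n \<Longrightarrow> (\<lambda>\<omega>. S \<omega> i) \<in> borel_measurable (PiM {..<N} (\<lambda>_. p))"
    and S_min: "\<And>\<omega> c. \<omega> \<in> space (PiM {..<N} (\<lambda>_. p)) \<Longrightarrow> J \<omega> (S \<omega>) \<le> J \<omega> c"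
    and r: "r > 0"
    and N: "N \<ge> 2"
    and sample_size: "real N / ln (real N)
        \<ge> (1 + r) * Kl / ((1 + lam * mumin) * cdelta (1 / (2 * (1 + lam * mumax))))"
  shows "(\<integral>\<omega>. (\<integral>\<mu>. (F \<mu> - Fstar \<omega> \<mu>)\<^sup>2 \<partial>p) \<partial>(PiM {..<N} (\<lambda>_. p)))
    \<le> 2 * eFn * (1 + cdelta (1/2) / (ln (real N) * (1 + r) * (1/2 + lam * mumin)\<^sup>2))
       + 4 * lam * pCE p DPnF DPnF + 2 * M\<^sup>2 * real N powr (- r)"
proof -
  interpret p: prob_space p by (rule p)
  have sp: "space p = space (PK K)" using p(2) by (rule sets_eq_imp_space_eq)
  define L where "L \<mu> = (\<lambda>i. ell i \<mu>)" for \<mu>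
  define B where "B \<mu> = (\<lambda>i j. \<integral>x. Dell i \<mu> x \<bullet> Dell j \<mu> x \<partial>\<mu>)" for \<mu>
  define w where "w = (\<lambda>i. \<integral>\<nu>. F \<nu> * L \<nu> i \<partial>p)"
  define m where "m i = pCE p (Dell i) (Dell i)" for i
  have bmp: "bounded_measurable p f \<longleftrightarrow> bounded_measurable (PK K) f" for f :: "'a measure \<Rightarrow> real"
    by (rule bounded_measurable_cong_sets[OF p(2)])
  have Lb: "bounded_measurable (PK K) (\<lambda>\<mu>. L \<mu> i)" if "i < n" for i
    unfolding L_def ell_def using bounded_measurable_cyl[of n \<psi> g\<psi> \<phi> g\<phi>, OF cyl that] by simp
  have Bb: "bounded_measurable (PK K) (\<lambda>\<mu>. B \<mu> i j)" if "i < n" "j < n" for i j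
    unfolding B_def Dell_def
    by (rule bounded_measurable_integral_Dcyl_inner[of n \<psi> g\<psi> \<phi> g\<phi>, OF cyl that])
  have quadB: "(\<integral>x. (norm (\<Sum>i<n. v i *\<^sub>R Dell i \<mu> x))\<^sup>2 \<partial>\<mu>) = dotp n v (mat_vec n (B \<mu>) v)"
    if "\<mu> \<in> space (PK K)" for \<mu> v
    unfolding B_def Dell_def
    by (rule integral_norm_sum_Dcyl[of n \<psi> g\<psi> \<phi> g\<phi>, OF cyl that])
  have sumL: "(\<Sum>i<n. c i * ell i \<mu>) = dotp n c (L \<mu>)" for c \<mu>
    by (simp add: dotp_def L_def)
  have Jeq: "J \<omega> c = (\<Sum>l<N. (F (\<omega> l) - dotp n c (L (\<omega> l)))\<^sup>2) / N
      + lam * ((\<Sum>l<N. dotp n c (mat_vec n (B (\<omega> l)) c)) / N)"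
    if "\<omega> \<in> space (PiM {..<N} (\<lambda>_. p))" for \<omega> c
  proof -
    have "\<omega> l \<in> space (PK K)" if "l < N" for l
      using \<open>\<omega> \<in> _\<close> that by (auto simp: space_PiM sp)
    then show ?thesis unfolding J_def sumL by (simp add: quadB)
  qed
  have m_bounds: "mumin \<le> m i" "m i \<le> mumax" if "i < n" for i
    using that by (auto simp: mumin_def mumax_def m_def)
  have m0: "0 \<le> m i" for i
    unfolding m_def pCE_def by simp
  \<comment> \<open>\<open>n\<close> \<ge> 1 makes the index set nonempty, so that
    \<open>Min\<close> is an actual minimum.\<close>
  have mumin0: "0 \<le> mumin"
    unfolding mumin_def using n m0 by (subst Min_ge_iff) (auto simp: m_def lessThan_empty_iff)
  have main: "(\<integral>\<omega>. (\<integral>\<mu>. (F \<mu> - max (- M) (min (dotp n (S \<omega>) (L \<mu>)) M))\<^sup>2 \<partial>p) \<partial>PiM {..<N} (\<lambda>_. p))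
    \<le> 2 * (\<integral>\<mu>. (F \<mu> - dotp n w (L \<mu>))\<^sup>2 \<partial>p)
        * (1 + cdelta (1 / 2) / (ln N * (1 + r) * (1 / 2 + lam * mumin)\<^sup>2))
      + 4 * lam * (\<integral>\<mu>. dotp n w (mat_vec n (B \<mu>) w) \<partial>p) + 2 * M\<^sup>2 * N powr (- r)"
    unfolding w_def
  proof (rule regularized_least_squares_risk[OF p(1) lam n r N])
    show "bounded_measurable p (\<lambda>x. L x i)" if "i < n" for i using Lb[OF that] by (simp add: bmp)
    show "bounded_measurable p (\<lambda>x. B x i j)" if "i < n" "j < n" for i j
      using Bb[OF that] by (simp add: bmp)
    show "mat_transpose (B x) = B x" for x by (auto simp: mat_transpose_def B_def inner_commute fun_eq_iff)
    show "0 \<le> dotp n v (mat_vec n (B x) v)" if "x \<in> space p" for x v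
      using that by (simp add: sp flip: quadB)
    show "(\<integral>x. L x i * L x j \<partial>p) = (if i = j then 1 else 0)" if "i < n" "j < n" for i j
      using orthonormal[OF that] by (simp add: L_def)
    show "(\<integral>x. B x i j \<partial>p) = (if i = j then m i else 0)" if "i < n" "j < n" for i j
      using pCE_orth[OF that] by (simp add: B_def m_def pCE_def)
    show "0 \<le> mumin" by (rule mumin0)
    show "mumin \<le> m i" if "i < n" for i by (rule m_bounds[OF that])
    show "mumin \<le> mumax" using m_bounds[of 0] n by simp
    show "F \<in> borel_measurable p" using F_meas measurable_cong_sets[OF p(2) refl] by blast
    show "\<bar>F x\<bar> \<le> M" if "x \<in> space p" for x using F_bound that by (simp add: sp)
    show "(1 + r) * Kl / ((1 + lam * mumin) * cdelta (1 / (2 * (1 + lam * mumax)))) \<le> real N / ln (real N)"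
      by (rule sample_size)
    show "(\<Sum>i<n. (L x i)\<^sup>2 + lam * B x i i) \<le> Kl" if x: "x \<in> space p" for x
    proof -
      let ?T = "\<lambda>\<mu>. \<Sum>i<n. (ell i \<mu>)\<^sup>2 + lam * (\<integral>x. (norm (Dell i \<mu> x))\<^sup>2 \<partial>\<mu>)"
      have T: "?T \<mu> = (\<Sum>i<n. (L \<mu> i)\<^sup>2 + lam * B \<mu> i i)" for \<mu>
        by (simp add: L_def B_def power2_norm_eq_inner)
      have "bounded_measurable (PK K) ?T"
        unfolding T by (intro bounded_measurable_intros Lb Bb) auto
      then obtain C where "\<forall>\<mu>\<in>space (PK K). \<bar>?T \<mu>\<bar> \<le> C"
        unfolding bounded_measurable_def by blast
      \<comment> \<open>A real supremum is an upper bound only of a set bounded above; the bound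
        comes from the boundedness built into \<open>C1b_grad\<close>.\<close>
      then have "bdd_above (?T ` space (PK K))"
        by (intro bdd_aboveI2[where M=C]) (meson abs_le_D1)
      then have "?T x \<le> Kl"
        unfolding Kl_def using x by (intro cSUP_upper) (simp_all add: sp)
      then show ?thesis by (simp only: T)
    qed
    show "(\<Sum>l<N. (F (\<omega> l) - dotp n (S \<omega>) (L (\<omega> l)))\<^sup>2) / N
        + lam * ((\<Sum>l<N. dotp n (S \<omega>) (mat_vec n (B (\<omega> l)) (S \<omega>))) / N)
      \<le> (\<Sum>l<N. (F (\<omega> l) - dotp n c (L (\<omega> l)))\<^sup>2) / N
        + lam * ((\<Sum>l<N. dotp n c (mat_vec n (B (\<omega> l)) c)) / N)"
      if "\<omega> \<in> space (PiM {..<N} (\<lambda>_. p))" for \<omega> c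
      using S_min[OF that, of c] unfolding Jeq[OF that] .
  qed
  have "PnF = (\<lambda>\<mu>. dotp n w (L \<mu>))"
    by (simp add: PnF_def w_def dotp_def L_def)
  then have e: "eFn = (\<integral>\<mu>. (F \<mu> - dotp n w (L \<mu>))\<^sup>2 \<partial>p)"
    unfolding eFn_def by (simp add: power2_commute)
  have q: "pCE p DPnF DPnF = (\<integral>\<mu>. dotp n w (mat_vec n (B \<mu>) w) \<partial>p)"
    unfolding pCE_def
  proof (rule Bochner_Integration.integral_cong[OF refl])
    fix \<mu> assume "\<mu> \<in> space p"
    then show "(\<integral>x. DPnF \<mu> x \<bullet> DPnF \<mu> x \<partial>\<mu>) = dotp n w (mat_vec n (B \<mu>) w)"
      using quadB[of \<mu> w] by (simp add: sp DPnF_def w_def L_def power2_norm_eq_inner)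
  qed
  show ?thesis
    using main unfolding Fstar_def sumL e q .
qed

end
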